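(* In the AMLI-cycle setting described in the context, assume that the two-grid method converges uniformly with convergence rate $\delta_{TG}$. Let $0<a<2$, let $\widetilde p_3(\widetilde x)=2(1-a\widetilde x)^2(1-2\widetilde x)-(1-a\widetilde x)(1-\widetilde x)$, and let $\widetilde\nu\in(0,1)$ be such that $\widetilde p_3(\widetilde\nu)\ge0$, $\widetilde p_3$ is decreasing on $(0,\widetilde\nu]$, and $\widetilde p_3(\widetilde\nu)\ge\max_{\widetilde x\in[\widetilde\nu,1]}\widetilde p_3(\widetilde x)$. Set $$L=\begin{cases}1-\widetilde p_3\left(\frac{2a+7-\sqrt{4(1-a)^2+9}}{12a}\right),&0<a<\frac{9+2\sqrt{22}}{14},\\[4pt] 1+2(a-1)^2,&\frac{9+2\sqrt{22}}{14}\le a<2,\end{cases}\qquad p_3(x)=\widetilde p_3\left(\frac xL\right).$$ Then the AMLI operators $B_\ell$ defined with the polynomial $p=p_3$ satisfy $$\kappa(B_\ell A_\ell)\le\frac L\mu\quad\text{for all levels }\ell,$$ provided there exists $0<\mu\le\bar\mu:=\min\{L\widetilde\nu,\,1-\delta_{TG}\}$ such that $$\mu\le(1-\delta_{TG})\left[1-p_3(\mu)\right].$$ Moreover, a sufficient condition for the existence of such a $\mu$ is $$\delta_{TG}<\begin{cases}1-\dfrac{1-\widetilde p_3\left(\frac{2a+7-\sqrt{4(1-a)^2+9}}{12a}\right)}{3a+3},&0<a<\frac{9+2\sqrt{22}}{14},\\[10pt] 1-\dfrac{1+2(a-1)^2}{3a+3},&\frac{9+2\sqrt{22}}{14}\le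 a<2.\end{cases}$$
   Context: AMLI-cycle setting. SPD means symmetric positive definite. Let $J\ge 2$ be the number of levels. For $\ell=1,\dots,J$ let $A_\ell\in\mathbb{R}^{n_\ell\times n_\ell}$ be SPD, and for $\ell=1,\dots,J-1$ let $P_\ell\in\mathbb{R}^{n_\ell\times n_{\ell+1}}$ (prolongation) be such that $A_{\ell+1}=P_\ell^TA_\ell P_\ell$. For $\ell=1,\dots,J-1$ let $M_\ell\in\mathbb{R}^{n_\ell\times n_\ell}$ be a nonsingular matrix (smoother) which is nonexpansive: $\|I-M_\ell A_\ell\|_{A_\ell}\le 1$, where $\|\cdot\|_{A_\ell}$ is the operator norm induced by the inner product $(u,v)_{A_\ell}=(A_\ell u,v)$. Put $\overline{M}_\ell:=M_\ell^T(M_\ell^{-1}+M_\ell^{-T}-A_\ell)M_\ell=M_\ell+M_\ell^T-M_\ell^TA_\ell M_\ell$. Given a polynomial $p$ with $p(0)=1$, the AMLI operators are defined recursively from the coarsest level by $B_J=\widehat B_J=A_J^{-1}$, and $$B_\ell=\overline M_\ell+(I-M_\ell^TA_\ell)P_\ell\widehat B_{\ell+1}P_\ell^T(I-A_\ell M_\ell),\quad \ell=J-1,\dots,1,$$ $$\widehat B_\ell=(I-p(B_\ell A_\ell))A_\ell^{-1},\quad \ell=2,\dots,J-1.$$ The two-grid operator on level $\ell\le J-1$ is $B^{TG}_\ell=\overline M_\ell+(I-M_\ell^TA_\ell)P_\ell A_{\ell+1}^{-1}P_\ell^T(I-A_\ell M_\ell)$. "The two-grid method converges uniformly with convergence rate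 $\delta_{TG}$" means that $\delta_{TG}\in[0,1)$ and, for all $\ell=1,\dots,J-1$, $\lambda_{\min}(B_\ell^{TG}A_\ell)\ge 1-\delta_{TG}$ and $\lambda_{\max}(B_\ell^{TG}A_\ell)\le 1$. $\kappa(B_\ell A_\ell)=\lambda_{\max}(B_\ell A_\ell)/\lambda_{\min}(B_\ell A_\ell)$; a bound $\kappa(B_\ell A_\ell)\le C$ means that all eigenvalues of $B_\ell A_\ell$ are positive and $\lambda_{\max}\le C\lambda_{\min}$. $\widetilde p_3$ is the momentum-accelerated (MA) polynomial of degree 3, from the recurrence $\widetilde p_{k+1}(\widetilde x)=2(1-a\widetilde x)\widetilde p_k(\widetilde x)-(1-a\widetilde x)\widetilde p_{k-1}(\widetilde x)$, $\widetilde p_0=1$, $\widetilde p_1=1-\widetilde x$. *)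

theory Defs
  imports "Jordan_Normal_Form.Spectral_Radius" "Jordan_Normal_Form.Gauss_Jordan_Elimination"
begin

definition spd :: "real mat \<Rightarrow> bool" where
  "spd A \<longleftrightarrow> square_mat A \<and> transpose_mat A = A \<and>
     (\<forall>v \<in> carrier_vec (dim_row A). v \<noteq> 0\<^sub>v (dim_row A) \<longrightarrow> 0 < scalar_prod (A *\<^sub>v v) v)"

(* A meaningful value only for invertible A. *)
definition minv :: "real mat \<Rightarrow> real mat" where
  "minv A = the (mat_inverse A)"

definition energy_norm :: "real mat \<Rightarrow> real vec \<Rightarrow> real" where
  "energy_norm A v = sqrt (scalar_prod (A *\<^sub>v v) v)"

(* Only used for SPD A of positive dimension, where the supremum is over a nonempty bounded set. *)
definition energy_onorm :: "real mat \<Rightarrow> real mat \<Rightarrow> real" where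
  "energy_onorm A T =
     (SUP v \<in> {v \<in> carrier_vec (dim_row A). v \<noteq> 0\<^sub>v (dim_row A)}.
        energy_norm A (T *\<^sub>v v) / energy_norm A v)"

(* Extreme real eigenvalues. They are applied to products B * A with B symmetric and A SPD;
   such a product is self-adjoint for the inner product of A, so its spectrum is real and nonempty. *)
definition lambda_min :: "real mat \<Rightarrow> real" where
  "lambda_min X = Min (spectrum X)"

definition lambda_max :: "real mat \<Rightarrow> real" where
  "lambda_max X = Max (spectrum X)"

(* The first conjunct ranges over the complex eigenvalues, so it excludes nonreal ones too. *)
definition cond_le :: "real mat \<Rightarrow> real \<Rightarrow> bool" where
  "cond_le X C \<longleftrightarrow>
     (\<forall>z \<in> spectrum (map_mat complex_of_real X). z \<in> \<real> \<and> 0 < Re z) \<and>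
     lambda_max X \<le> C * lambda_min X"

(* p(X) for a square matrix X *)
definition poly_mat :: "real poly \<Rightarrow> real mat \<Rightarrow> real mat" where
  "poly_mat p X = mat (dim_row X) (dim_row X)
     (\<lambda>(i, j). \<Sum>k\<le>degree p. coeff p k * (X ^\<^sub>m k) $$ (i, j))"

definition symmetrized_smoother :: "real mat \<Rightarrow> real mat \<Rightarrow> real mat" where
  "symmetrized_smoother A M =
     transpose_mat M * (minv M + transpose_mat (minv M) - A) * M"

(* One symmetric cycle on a level with matrix A, smoother M and prolongation P,
   with C as the coarse-level solver. *)
definition cycle_op :: "real mat \<Rightarrow> real mat \<Rightarrow> real mat \<Rightarrow> real mat \<Rightarrow> real mat" where
  "cycle_op A M P C = symmetrized_smoother A M +
     (1\<^sub>m (dim_row A) - transpose_mat M * A) * P * C * transpose_mat P *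
     (1\<^sub>m (dim_row A) - A * M)"

definition amli_setting ::
    "nat \<Rightarrow> (nat \<Rightarrow> nat) \<Rightarrow> (nat \<Rightarrow> real mat) \<Rightarrow> (nat \<Rightarrow> real mat) \<Rightarrow> (nat \<Rightarrow> real mat) \<Rightarrow> bool" where
  "amli_setting J n A P M \<longleftrightarrow>
     2 \<le> J \<and>
     (\<forall>l \<in> {1..J}. 0 < n l \<and> A l \<in> carrier_mat (n l) (n l) \<and> spd (A l)) \<and>
     (\<forall>l \<in> {1..<J}. P l \<in> carrier_mat (n l) (n (l + 1)) \<and>
        A (l + 1) = transpose_mat (P l) * A l * P l) \<and>
     (\<forall>l \<in> {1..<J}. M l \<in> carrier_mat (n l) (n l) \<and> invertible_mat (M l) \<and>
        energy_onorm (A l) (1\<^sub>m (n l) - M l * A l) \<le> 1)"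

(* amli_B is the operator B, amli_Bhat the polynomially corrected operator used as coarse solver
   on the next finer level. Both equal the exact inverse on the coarsest level J; indices above J
   are only totality padding. *)
function
  amli_B :: "real poly \<Rightarrow> nat \<Rightarrow> (nat \<Rightarrow> real mat) \<Rightarrow> (nat \<Rightarrow> real mat) \<Rightarrow> (nat \<Rightarrow> real mat) \<Rightarrow> nat \<Rightarrow> real mat"
and
  amli_Bhat :: "real poly \<Rightarrow> nat \<Rightarrow> (nat \<Rightarrow> real mat) \<Rightarrow> (nat \<Rightarrow> real mat) \<Rightarrow> (nat \<Rightarrow> real mat) \<Rightarrow> nat \<Rightarrow> real mat"
where
  "amli_B p J A P M l =
     (if l < J then cycle_op (A l) (M l) (P l) (amli_Bhat p J A P M (l + 1)) else minv (A J))"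
| "amli_Bhat p J A P M l =
     (if l < J
      then (1\<^sub>m (dim_row (A l)) - poly_mat p (amli_B p J A P M l * A l)) * minv (A l)
      else minv (A J))"
  by pat_completeness auto
termination
  by (relation "measure (\<lambda>x. case x of Inl (p, J, A, P, M, l) \<Rightarrow> 2 * (J - l)
        | Inr (p, J, A, P, M, l) \<Rightarrow> 2 * (J - l) + 1)") auto

declare amli_B.simps [simp del] amli_Bhat.simps [simp del]

definition two_grid_op ::
    "(nat \<Rightarrow> real mat) \<Rightarrow> (nat \<Rightarrow> real mat) \<Rightarrow> (nat \<Rightarrow> real mat) \<Rightarrow> nat \<Rightarrow> real mat" where
  "two_grid_op A P M l = cycle_op (A l) (M l) (P l) (minv (A (l + 1)))"

definition two_grid_converges ::
    "nat \<Rightarrow> (nat \<Rightarrow> real mat) \<Rightarrow> (nat \<Rightarrow> real mat) \<Rightarrow> (nat \<Rightarrow> real mat) \<Rightarrow> real \<Rightarrow> bool" where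
  "two_grid_converges J A P M \<delta> \<longleftrightarrow>
     0 \<le> \<delta> \<and> \<delta> < 1 \<and>
     (\<forall>l \<in> {1..<J}. 1 - \<delta> \<le> lambda_min (two_grid_op A P M l * A l) \<and>
        lambda_max (two_grid_op A P M l * A l) \<le> 1)"

fun ma_poly :: "real \<Rightarrow> nat \<Rightarrow> real poly" where
  "ma_poly a 0 = 1"
| "ma_poly a (Suc 0) = [:1, -1:]"
| "ma_poly a (Suc (Suc k)) =
     2 * [:1, -a:] * ma_poly a (Suc k) - [:1, -a:] * ma_poly a k"

definition ma_poly3 :: "real \<Rightarrow> real poly" where
  "ma_poly3 a = 2 * [:1, -a:]^2 * [:1, -2:] - [:1, -a:] * [:1, -1:]"

lemma ma_poly3_eq: "ma_poly3 a = ma_poly a 3"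
proof -
  have r: "[:1, -2:] = 2 * [:1, -1:] - (1 :: real poly)"
    by (simp add: one_pCons numeral_poly)
  have alg: "2 * q\<^sup>2 * (2 * s - 1) - q * s = 2 * q * (2 * q * s - q * 1) - q * s" for q s :: "real poly"
    by (simp add: power2_eq_square ring_distribs)
  show ?thesis
    by (simp only: ma_poly3_def r alg numeral_3_eq_3 ma_poly.simps)
qed

lemma poly_ma_poly3:
  "poly (ma_poly3 a) x = 2 * (1 - a * x)^2 * (1 - 2 * x) - (1 - a * x) * (1 - x)"
  by (simp add: ma_poly3_def algebra_simps)

definition ma3_L :: "real \<Rightarrow> real" where
  "ma3_L a =
     (if a < (9 + 2 * sqrt 22) / 14
      then 1 - poly (ma_poly3 a) ((2 * a + 7 - sqrt (4 * (1 - a)^2 + 9)) / (12 * a))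
      else 1 + 2 * (a - 1)^2)"

definition ma3_scaled :: "real \<Rightarrow> real poly" where
  "ma3_scaled a = pcompose (ma_poly3 a) [:0, 1 / ma3_L a:]"

end

theory Submission
  imports Defs
begin

text \<open>
  Everything is read off quadratic forms. For a symmetric preconditioner \<open>B\<close> the matrix
  \<open>T = B A\<close> is self-adjoint for the inner product of \<open>A\<close>, and its spectrum lies in
  \<open>[lo, hi]\<close> exactly when \<open>lo (A v, v) \<le> (A T v, v) \<le> hi (A v, v)\<close> for all \<open>v\<close>. In this form
  the bounds survive the passage from one level to the next by pointwise arithmetic.

  The induction runs from the coarsest level upwards and carries \<open>[\<mu>, L]\<close> for \<open>B\<close> and
  \<open>[\<mu> / (1 - \<delta>), L]\<close> for the polynomially corrected coarse solver. Two facts drive it.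
  The first is spectral mapping: if \<open>T\<close> has bounds \<open>[\<mu>, L]\<close>, then \<open>1 - p(T)\<close> has as bounds any
  bounds of \<open>1 - p\<close> on \<open>[\<mu>, L]\<close> (\<open>energy_bounds_poly_mat\<close>). The second is that the form of a
  cycle with coarse solver \<open>C\<close> is the form of the symmetrized smoother plus the form of \<open>C\<close> at a
  restricted residual. The first summand is nonnegative because the smoother is nonexpansive, so if
  \<open>C\<close> lies between \<open>m\<close> and \<open>L\<close> times the exact coarse inverse with \<open>m \<le> 1 \<le> L\<close>, then the cycle lies
  between \<open>m\<close> and \<open>L\<close> times the two-grid operator (\<open>cycle_op_energy_bounds\<close>). The two-grid
  bounds \<open>[1 - \<delta>, 1]\<close> turn this into \<open>[m (1 - \<delta>), L]\<close>, and \<open>m = \<mu> / (1 - \<delta>)\<close> closes the circle.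
  This works for every polynomial \<open>p\<close> with \<open>\<mu> / (1 - \<delta>) \<le> 1 - p \<le> L\<close> on \<open>[\<mu>, L]\<close>
  (\<open>amli_condition_number\<close>).

  What remains concerns the cubic. The upper bound says that \<open>1 - L\<close> bounds the unscaled cubic from
  below on \<open>[0, 1]\<close>. Depending on \<open>a\<close>, the number \<open>1 - L\<close> is the value at the first critical
  point or at the endpoint \<open>1\<close>; subtracting it from the cubic leaves a product
  with a visible sign, and the two cases are separated by a quadratic in \<open>a\<close> whose positive root is
  \<open>(9 + 2 * sqrt 22) / 14\<close>. The lower bound asks for the largest value of the scaled cubic on
  \<open>[\<mu>, L]\<close>, which the hypotheses on \<open>\<nu>\<close> place at \<open>\<mu>\<close>. A suitable \<open>\<mu>\<close> exists as soon as the
  derivative of \<open>(1 - \<delta>) (1 - p)\<close> at \<open>0\<close>, which is \<open>(1 - \<delta>) (3 a + 3) / L\<close>, exceeds \<open>1\<close>.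
\<close>

section \<open>Quadratic forms of symmetric matrices\<close>

definition qform :: "real mat \<Rightarrow> real vec \<Rightarrow> real" where
  "qform X v = (X *\<^sub>v v) \<bullet> v"

definition symmetric_mat :: "real mat \<Rightarrow> bool" where
  "symmetric_mat X \<longleftrightarrow> transpose_mat X = X"

lemma qform_add:
  assumes "X \<in> carrier_mat n n" "Y \<in> carrier_mat n n" "v \<in> carrier_vec n"
  shows "qform (X + Y) v = qform X v + qform Y v"
  using assms by (simp add: qform_def add_mult_distrib_mat_vec[of _ n n] add_scalar_prod_distrib[of _ n])

lemma qform_minus:
  assumes "X \<in> carrier_mat n n" "Y \<in> carrier_mat n n" "v \<in> carrier_vec n"
  shows "qform (X - Y) v = qform X v - qform Y v"
  using assms by (simp add: qform_def minus_mult_distrib_mat_vec[of _ n n] minus_scalar_prod_distrib[of _ n])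

lemma smult_mat_mult_vec:
  fixes X :: "real mat"
  assumes "X \<in> carrier_mat m n" "v \<in> carrier_vec n"
  shows "(c \<cdot>\<^sub>m X) *\<^sub>v v = c \<cdot>\<^sub>v (X *\<^sub>v v)"
  using assms by (auto intro!: eq_vecI)

lemma transpose_smult_mat: "transpose_mat (c \<cdot>\<^sub>m X) = c \<cdot>\<^sub>m transpose_mat X"
  by (auto intro!: eq_matI)

lemma qform_smult:
  assumes "X \<in> carrier_mat n n" "v \<in> carrier_vec n"
  shows "qform (c \<cdot>\<^sub>m X) v = c * qform X v"
  using assms by (simp add: qform_def smult_mat_mult_vec[of _ n n])

lemma scalar_prod_transpose:
  fixes X :: "real mat"
  assumes "X \<in> carrier_mat m n" "u \<in> carrier_vec n" "v \<in> carrier_vec m"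
  shows "(X *\<^sub>v u) \<bullet> v = u \<bullet> (transpose_mat X *\<^sub>v v)"
  using transpose_vec_mult_scalar[of "transpose_mat X" n m v u] assms
  by (metis comm_scalar_prod mult_mat_vec_carrier transpose_carrier_mat transpose_transpose
      transpose_vec_mult_scalar)

lemma scalar_prod_symmetric_mat:
  assumes "X \<in> carrier_mat n n" "symmetric_mat X" "u \<in> carrier_vec n" "v \<in> carrier_vec n"
  shows "(X *\<^sub>v u) \<bullet> v = (X *\<^sub>v v) \<bullet> u"
  using assms scalar_prod_transpose[of X n n u v] comm_scalar_prod[of u n "X *\<^sub>v v"]
  by (simp add: symmetric_mat_def)

lemma qform_congruence:
  assumes "C \<in> carrier_mat m m" "Y \<in> carrier_mat m n" "v \<in> carrier_vec n"
  shows "qform (transpose_mat Y * C * Y) v = qform C (Y *\<^sub>v v)"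
proof -
  have "(transpose_mat Y * C * Y) *\<^sub>v v = transpose_mat Y *\<^sub>v (C *\<^sub>v (Y *\<^sub>v v))"
    using assms by (simp add: assoc_mult_mat_vec[of _ n m _ m] assoc_mult_mat_vec[of _ n m _ n])
  then show ?thesis
    using assms scalar_prod_transpose[of "transpose_mat Y" n m "C *\<^sub>v (Y *\<^sub>v v)" v]
    by (simp add: qform_def)
qed

lemma symmetric_mat_congruence:
  assumes "C \<in> carrier_mat m m" "symmetric_mat C" "Y \<in> carrier_mat m n"
  shows "symmetric_mat (transpose_mat Y * C * Y)"
proof -
  have "transpose_mat (transpose_mat Y * C * Y) = transpose_mat Y * transpose_mat (transpose_mat Y * C)"
    using assms by (intro transpose_mult[of _ n m]) auto
  also have "transpose_mat (transpose_mat Y * C) = C * Y"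
    using assms transpose_mult[of "transpose_mat Y" n m C m] by (simp add: symmetric_mat_def)
  finally show ?thesis
    using assms by (simp add: symmetric_mat_def assoc_mult_mat[of _ n m _ m _ n])
qed

lemma spdD:
  assumes "spd A" "A \<in> carrier_mat n n"
  shows "symmetric_mat A"
    and "v \<in> carrier_vec n \<Longrightarrow> v \<noteq> 0\<^sub>v n \<Longrightarrow> 0 < qform A v"
    and "v \<in> carrier_vec n \<Longrightarrow> 0 \<le> qform A v"
proof -
  show "symmetric_mat A" using assms by (simp add: spd_def symmetric_mat_def)
  show pos: "0 < qform A v" if "v \<in> carrier_vec n" "v \<noteq> 0\<^sub>v n" for v
    using assms that by (auto simp: spd_def qform_def)
  show "0 \<le> qform A v" if "v \<in> carrier_vec n" for v
    using pos[OF that] assms by (cases "v = 0\<^sub>v n") (auto simp: qform_def intro: less_imp_le)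
qed

lemma qform_bounded:
  assumes X: "X \<in> carrier_mat n n"
  shows "\<exists>K > 0. \<forall>v \<in> carrier_vec n. \<bar>qform X v\<bar> \<le> K * (v \<bullet> v)"
proof (intro exI[of _ "1 + (\<Sum>i<n. \<Sum>j<n. \<bar>X $$ (i, j)\<bar>)"] conjI ballI)
  let ?K = "\<Sum>i<n. \<Sum>j<n. \<bar>X $$ (i, j)\<bar>"
  show "0 < 1 + ?K" by (intro add_pos_nonneg sum_nonneg) auto
  fix v :: "real vec" assume v: "v \<in> carrier_vec n"
  have vv: "v \<bullet> v = (\<Sum>j<n. (v $ j)\<^sup>2)"
    using v by (simp add: scalar_prod_def power2_eq_square lessThan_atLeast0)
  have entry: "\<bar>v $ i * v $ j\<bar> \<le> v \<bullet> v" if "i < n" "j < n" for i j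
  proof -
    have sq: "(v $ k)\<^sup>2 \<le> v \<bullet> v" if "k < n" for k
      unfolding vv using that by (intro member_le_sum) auto
    have "2 * \<bar>v $ i * v $ j\<bar> \<le> (v $ i)\<^sup>2 + (v $ j)\<^sup>2"
      using sum_squares_bound[of "\<bar>v $ i\<bar>" "\<bar>v $ j\<bar>"] by (simp add: abs_mult mult.assoc)
    then show ?thesis using sq[OF that(1)] sq[OF that(2)] by linarith
  qed
  have "qform X v = (\<Sum>i<n. \<Sum>j<n. X $$ (i, j) * (v $ i * v $ j))"
    using X v by (auto simp: qform_def scalar_prod_def row_def lessThan_atLeast0 sum_distrib_right
        intro!: sum.cong)
  then have "\<bar>qform X v\<bar> \<le> (\<Sum>i<n. \<Sum>j<n. \<bar>X $$ (i, j)\<bar> * (v \<bullet> v))"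
    by (auto intro!: order.trans[OF sum_abs] sum_mono mult_left_mono entry simp: abs_mult[of "_ $$ _"])
  also have "\<dots> = ?K * (v \<bullet> v)" by (simp add: sum_distrib_right)
  also have "\<dots> \<le> (1 + ?K) * (v \<bullet> v)"
    by (simp add: vv sum_nonneg algebra_simps)
  finally show "\<bar>qform X v\<bar> \<le> (1 + ?K) * (v \<bullet> v)" .
qed

lemma invertible_of_trivial_kernel:
  fixes C :: "real mat"
  assumes C: "C \<in> carrier_mat n n" and inj: "\<And>v. v \<in> carrier_vec n \<Longrightarrow> C *\<^sub>v v = 0\<^sub>v n \<Longrightarrow> v = 0\<^sub>v n"
  obtains D where "D \<in> carrier_mat n n" "C * D = 1\<^sub>m n" "D * C = 1\<^sub>m n"
proof -
  have "det C \<noteq> 0" using det_0_iff_vec_prod_zero_field[OF C] inj by blast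
  then have "C \<in> Units (ring_mat TYPE(real) n n)" by (rule det_non_zero_imp_unit[OF C])
  then show ?thesis using that by (auto simp: Units_def ring_mat_simps)
qed

text \<open>
  With \<open>D\<close> the inverse of \<open>C\<close>, evaluating the form at \<open>v - s D v\<close> gives
  \<open>0 \<le> (C v, v) - 2 s (v, v) + s\<^sup>2 (D v, v)\<close>, and the last term is at most \<open>s (v, v)\<close> if \<open>s = 1 / K\<close>
  for a bound \<open>K\<close> of the form of \<open>D\<close>. What is left is \<open>s (v, v) \<le> (C v, v)\<close>.
\<close>

lemma coercive_of_semidefinite_trivial_kernel:
  assumes C: "C \<in> carrier_mat n n" "symmetric_mat C"
    and psd: "\<And>v. v \<in> carrier_vec n \<Longrightarrow> 0 \<le> qform C v"
    and inj: "\<And>v. v \<in> carrier_vec n \<Longrightarrow> C *\<^sub>v v = 0\<^sub>v n \<Longrightarrow> v = 0\<^sub>v n"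
  shows "\<exists>\<epsilon> > 0. \<forall>v \<in> carrier_vec n. \<epsilon> * (v \<bullet> v) \<le> qform C v"
proof -
  obtain D where D: "D \<in> carrier_mat n n" "C * D = 1\<^sub>m n"
    using invertible_of_trivial_kernel[OF C(1) inj] by blast
  obtain K where K: "K > 0" "\<And>v. v \<in> carrier_vec n \<Longrightarrow> \<bar>qform D v\<bar> \<le> K * (v \<bullet> v)"
    using qform_bounded[OF D(1)] by blast
  have "inverse K * (v \<bullet> v) \<le> qform C v" if v: "v \<in> carrier_vec n" for v :: "real vec"
  proof -
    define w where "w = D *\<^sub>v v"
    have w: "w \<in> carrier_vec n" using D v by (simp add: w_def)
    have Cw: "C *\<^sub>v w = v"
      using C D v by (simp add: w_def assoc_mult_mat_vec[of _ n n _ n, symmetric])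
    let ?s = "inverse K"
    have sw: "?s \<cdot>\<^sub>v w \<in> carrier_vec n" using w by simp
    have Cv: "C *\<^sub>v v \<in> carrier_vec n" using C v by simp
    have e: "C *\<^sub>v (v - ?s \<cdot>\<^sub>v w) = C *\<^sub>v v - ?s \<cdot>\<^sub>v v"
      using C v w by (simp add: mult_minus_distrib_mat_vec[of _ n n] mult_mat_vec[of _ n n] Cw)
    have wv: "w \<bullet> v = qform D v" by (simp add: qform_def w_def)
    have vw: "v \<bullet> w = qform D v" using wv comm_scalar_prod[OF v w] by simp
    have Cvw: "(C *\<^sub>v v) \<bullet> w = v \<bullet> v"
      using scalar_prod_symmetric_mat[OF C v w] Cw by simp
    have "0 \<le> qform C (v - ?s \<cdot>\<^sub>v w)" using psd v w by simp
    also have "\<dots> = qform C v - 2 * ?s * (v \<bullet> v) + ?s * ?s * qform D v"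
      unfolding qform_def[of C] e using v w Cv sw
      by (simp add: minus_scalar_prod_distrib[of _ n] scalar_prod_minus_distrib[of _ n] vw Cvw algebra_simps)
    also have "?s * ?s * qform D v \<le> ?s * ?s * (K * (v \<bullet> v))"
      using K v by (intro mult_left_mono) (auto intro: order.trans[OF abs_ge_self])
    also have "?s * ?s * (K * (v \<bullet> v)) = ?s * (v \<bullet> v)" using K by simp
    finally show ?thesis by simp
  qed
  then show ?thesis using K(1) by (intro exI[of _ "inverse K"]) simp
qed

lemma spd_kernel_trivial:
  assumes "A \<in> carrier_mat n n" "spd A" "v \<in> carrier_vec n" "A *\<^sub>v v = 0\<^sub>v n"
  shows "v = 0\<^sub>v n"
  using spdD(2)[OF assms(2,1,3)] assms(3,4) by (fastforce simp: qform_def)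

lemma spd_coercive:
  assumes A: "A \<in> carrier_mat n n" "spd A"
  shows "\<exists>\<epsilon> > 0. \<forall>v \<in> carrier_vec n. \<epsilon> * (v \<bullet> v) \<le> qform A v"
  by (rule coercive_of_semidefinite_trivial_kernel[OF A(1) spdD(1)[OF A(2,1)] spdD(3)[OF A(2,1)]
        spd_kernel_trivial[OF A]])

text \<open>
  The minimum of the generalized Rayleigh quotient is attained and is an eigenvalue of the pencil.
  Take for \<open>t\<close> the largest number with \<open>S - t A\<close> positive semidefinite. If \<open>S - t A\<close> had a trivial
  kernel, it would be coercive and \<open>t\<close> could still be increased; so it has a kernel vector.
\<close>

lemma rayleigh_minimum:
  assumes A: "A \<in> carrier_mat n n" "spd A" and S: "S \<in> carrier_mat n n" "symmetric_mat S" and n: "0 < n"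
  obtains t w where "w \<in> carrier_vec n" "w \<noteq> 0\<^sub>v n" "S *\<^sub>v w = t \<cdot>\<^sub>v (A *\<^sub>v w)"
    "\<And>v. v \<in> carrier_vec n \<Longrightarrow> t * qform A v \<le> qform S v"
proof -
  define I where "I = {t. \<forall>v \<in> carrier_vec n. t * qform A v \<le> qform S v}"
  obtain \<epsilon> where \<epsilon>: "\<epsilon> > 0" "\<And>v. v \<in> carrier_vec n \<Longrightarrow> \<epsilon> * (v \<bullet> v) \<le> qform A v"
    using spd_coercive[OF A] by blast
  obtain K where K: "K > 0" "\<And>v. v \<in> carrier_vec n \<Longrightarrow> \<bar>qform S v\<bar> \<le> K * (v \<bullet> v)"
    using qform_bounded[OF S(1)] by blast
  obtain K' where K': "K' > 0" "\<And>v. v \<in> carrier_vec n \<Longrightarrow> \<bar>qform A v\<bar> \<le> K' * (v \<bullet> v)"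
    using qform_bounded[OF A(1)] by blast
  have "- (K / \<epsilon>) \<in> I" unfolding I_def
  proof safe
    fix v :: "real vec" assume v: "v \<in> carrier_vec n"
    have "K * (v \<bullet> v) \<le> (K / \<epsilon>) * qform A v"
      using \<epsilon>(2)[OF v] \<epsilon>(1) K(1) by (simp add: field_simps)
    then show "- (K / \<epsilon>) * qform A v \<le> qform S v" using K(2)[OF v] by linarith
  qed
  then have ne: "I \<noteq> {}" by blast
  have e0: "unit_vec n 0 \<in> carrier_vec n" "unit_vec n 0 \<noteq> (0\<^sub>v n :: real vec)"
    using n by (auto simp: unit_vec_def vec_eq_iff zero_vec_def)
  have bdd: "bdd_above I"
  proof (rule bdd_aboveI)
    fix t assume "t \<in> I"
    then show "t \<le> qform S (unit_vec n 0) / qform A (unit_vec n 0)"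
      using e0 spdD(2)[OF A(2,1) e0] by (simp add: I_def pos_le_divide_eq)
  qed
  define t where "t = Sup I"
  have t: "t * qform A v \<le> qform S v" if v: "v \<in> carrier_vec n" for v :: "real vec"
  proof (cases "v = 0\<^sub>v n")
    case True
    then show ?thesis using A S by (simp add: qform_def)
  next
    case False
    have "t \<le> qform S v / qform A v" unfolding t_def
      using spdD(2)[OF A(2,1) v False] v by (intro cSup_least[OF ne]) (auto simp: I_def pos_le_divide_eq)
    then show ?thesis using spdD(2)[OF A(2,1) v False] by (simp add: pos_le_divide_eq)
  qed
  define C where "C = S - t \<cdot>\<^sub>m A"
  have C: "C \<in> carrier_mat n n" "symmetric_mat C"
    using A(1) S spdD(1)[OF A(2,1)] unfolding C_def symmetric_mat_def
    by (auto simp: transpose_minus[of _ n n] transpose_smult_mat)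
  have qC: "qform C v = qform S v - t * qform A v" if "v \<in> carrier_vec n" for v
    using that A(1) S(1) by (simp add: C_def qform_minus[of _ n] qform_smult[of _ n])
  have "\<exists>w \<in> carrier_vec n. w \<noteq> 0\<^sub>v n \<and> C *\<^sub>v w = 0\<^sub>v n"
  proof (rule ccontr)
    assume *: "\<not> ?thesis"
    obtain \<eta> where \<eta>: "\<eta> > 0" "\<And>v. v \<in> carrier_vec n \<Longrightarrow> \<eta> * (v \<bullet> v) \<le> qform C v"
      using coercive_of_semidefinite_trivial_kernel[OF C] t qC * by fastforce
    have "t + \<eta> / K' \<in> I" unfolding I_def
    proof safe
      fix v :: "real vec" assume v: "v \<in> carrier_vec n"
      have "\<eta> / K' * qform A v \<le> \<eta> / K' * (K' * (v \<bullet> v))"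
        using K' \<eta>(1) v by (intro mult_left_mono) (auto intro: order.trans[OF abs_ge_self])
      also have "\<dots> = \<eta> * (v \<bullet> v)" using K'(1) by simp
      also have "\<dots> \<le> qform S v - t * qform A v" using \<eta>(2)[OF v] qC[OF v] by simp
      finally show "(t + \<eta> / K') * qform A v \<le> qform S v" by (simp add: algebra_simps)
    qed
    then have "t + \<eta> / K' \<le> t" unfolding t_def by (rule cSup_upper[OF _ bdd])
    then show False using \<eta>(1) K'(1) by (simp add: divide_le_0_iff)
  qed
  then obtain w where w: "w \<in> carrier_vec n" "w \<noteq> 0\<^sub>v n" and Cw: "C *\<^sub>v w = 0\<^sub>v n" by blast
  have "S *\<^sub>v w - t \<cdot>\<^sub>v (A *\<^sub>v w) = 0\<^sub>v n"
    using Cw A(1) S(1) w(1)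
    by (simp add: C_def minus_mult_distrib_mat_vec[of _ n n] smult_mat_mult_vec[of _ n n])
  then have "S *\<^sub>v w = t \<cdot>\<^sub>v (A *\<^sub>v w)"
    using A(1) S(1) w(1) by (auto simp: vec_eq_iff)
  then show ?thesis using that w t by blast
qed

section \<open>Eigenvalues and energy bounds of self-adjoint matrices\<close>

text \<open>
  From here on, symmetry of \<open>A * T\<close> expresses that \<open>T\<close> is self-adjoint for the inner product
  of \<open>A\<close>.
\<close>

lemma selfadjoint_swap:
  assumes A: "A \<in> carrier_mat n n" "symmetric_mat A" and T: "T \<in> carrier_mat n n" "symmetric_mat (A * T)"
    and u: "u \<in> carrier_vec n" and v: "v \<in> carrier_vec n"
  shows "(A *\<^sub>v (T *\<^sub>v u)) \<bullet> v = (A *\<^sub>v u) \<bullet> (T *\<^sub>v v)"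
proof -
  have "(A *\<^sub>v (T *\<^sub>v u)) \<bullet> v = (A *\<^sub>v (T *\<^sub>v v)) \<bullet> u"
    using scalar_prod_symmetric_mat[of "A * T" n u v] A T u v by (simp add: assoc_mult_mat_vec[of _ n n _ n])
  also have "\<dots> = (A *\<^sub>v u) \<bullet> (T *\<^sub>v v)"
    using scalar_prod_symmetric_mat[OF A, of "T *\<^sub>v v" u] T u v by simp
  finally show ?thesis .
qed

text \<open>
  Split a complex eigenvector as \<open>u + i v\<close>. Comparing \<open>(A T u, v)\<close> with \<open>(A u, T v)\<close> leaves
  \<open>Im z ((A u, u) + (A v, v)) = 0\<close>, and afterwards both \<open>u\<close> and \<open>v\<close>, if nonzero, are real
  eigenvectors.
\<close>

lemma eigenvalue_real_of_selfadjoint: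
  assumes A: "A \<in> carrier_mat n n" "spd A" and T: "T \<in> carrier_mat n n" "symmetric_mat (A * T)"
    and ev: "eigenvalue (map_mat complex_of_real T) z"
  shows "Im z = 0" and "eigenvalue T (Re z)"
proof -
  obtain w where w: "w \<in> carrier_vec n" "w \<noteq> 0\<^sub>v n" and Tw: "map_mat complex_of_real T *\<^sub>v w = z \<cdot>\<^sub>v w"
    using ev T by (auto simp: eigenvalue_def eigenvector_def)
  define u v where "u = map_vec Re w" and "v = map_vec Im w"
  have uv: "u \<in> carrier_vec n" "v \<in> carrier_vec n" using w by (auto simp: u_def v_def)
  have comp: "(\<Sum>j<n. complex_of_real (T $$ (i, j)) * w $ j) = z * w $ i" if "i < n" for i
    using arg_cong[OF Tw, of "\<lambda>x. x $ i"] T w that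
    by (auto simp: scalar_prod_def row_def lessThan_atLeast0)
  have Tu: "T *\<^sub>v u = Re z \<cdot>\<^sub>v u - Im z \<cdot>\<^sub>v v"
  proof (rule eq_vecI)
    fix i assume "i < dim_vec (Re z \<cdot>\<^sub>v u - Im z \<cdot>\<^sub>v v)"
    then have i: "i < n" using uv by simp
    show "(T *\<^sub>v u) $ i = (Re z \<cdot>\<^sub>v u - Im z \<cdot>\<^sub>v v) $ i"
      using arg_cong[OF comp[OF i], of Re] T w i
      by (auto simp: scalar_prod_def row_def lessThan_atLeast0 u_def v_def)
  qed (use T uv in auto)
  have Tv: "T *\<^sub>v v = Im z \<cdot>\<^sub>v u + Re z \<cdot>\<^sub>v v"
  proof (rule eq_vecI)
    fix i assume "i < dim_vec (Im z \<cdot>\<^sub>v u + Re z \<cdot>\<^sub>v v)"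
    then have i: "i < n" using uv by simp
    show "(T *\<^sub>v v) $ i = (Im z \<cdot>\<^sub>v u + Re z \<cdot>\<^sub>v v) $ i"
      using arg_cong[OF comp[OF i], of Im] T w i
      by (auto simp: scalar_prod_def row_def lessThan_atLeast0 u_def v_def)
  qed (use T uv in auto)
  have nz: "u \<noteq> 0\<^sub>v n \<or> v \<noteq> 0\<^sub>v n"
  proof (rule ccontr)
    assume "\<not> ?thesis"
    then have "u $ i = 0" "v $ i = 0" if "i < n" for i using that by auto
    then have "w $ i = 0" if "i < n" for i using that w by (auto simp: u_def v_def complex_eq_iff)
    then have "w = 0\<^sub>v n" using w by (auto intro!: eq_vecI)
    then show False using w by blast
  qed
  note symA = spdD(1)[OF A(2,1)]
  have Au: "A *\<^sub>v u \<in> carrier_vec n" "A *\<^sub>v v \<in> carrier_vec n" using A uv by auto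
  have "(A *\<^sub>v (Re z \<cdot>\<^sub>v u - Im z \<cdot>\<^sub>v v)) \<bullet> v = (A *\<^sub>v u) \<bullet> (Im z \<cdot>\<^sub>v u + Re z \<cdot>\<^sub>v v)"
    using selfadjoint_swap[OF A(1) symA T uv] by (simp only: Tu Tv)
  then have "Re z * ((A *\<^sub>v u) \<bullet> v) - Im z * qform A v = Im z * qform A u + Re z * ((A *\<^sub>v u) \<bullet> v)"
    using A(1) uv Au by (simp add: qform_def mult_minus_distrib_mat_vec[of _ n n] mult_mat_vec[of _ n n]
        minus_scalar_prod_distrib[of _ n] scalar_prod_add_distrib[of _ n])
  then have "Im z * (qform A u + qform A v) = 0" by (simp add: algebra_simps)
  moreover have "0 < qform A u + qform A v"
    using nz spdD(2,3)[OF A(2,1) uv(1)] spdD(2,3)[OF A(2,1) uv(2)] by fastforce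
  ultimately show im: "Im z = 0" by simp
  have "T *\<^sub>v u = Re z \<cdot>\<^sub>v u" "T *\<^sub>v v = Re z \<cdot>\<^sub>v v"
    unfolding Tu Tv im using uv by (auto intro!: eq_vecI)
  then show "eigenvalue T (Re z)"
    using nz uv T by (auto simp: eigenvalue_def eigenvector_def)
qed

definition energy_bounds :: "real mat \<Rightarrow> real mat \<Rightarrow> real \<Rightarrow> real \<Rightarrow> bool" where
  "energy_bounds A T lo hi \<longleftrightarrow> (\<forall>v \<in> carrier_vec (dim_row A).
     lo * qform A v \<le> qform (A * T) v \<and> qform (A * T) v \<le> hi * qform A v)"

lemma eigenvalue_in_energy_bounds:
  assumes A: "A \<in> carrier_mat n n" "spd A" and T: "T \<in> carrier_mat n n"
    and b: "energy_bounds A T lo hi" and t: "w \<in> carrier_vec n" "w \<noteq> 0\<^sub>v n" "T *\<^sub>v w = t \<cdot>\<^sub>v w"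
  shows "lo \<le> t" "t \<le> hi"
proof -
  have "qform (A * T) w = t * qform A w"
    using A T t by (simp add: qform_def assoc_mult_mat_vec[of _ n n _ n] mult_mat_vec[of _ n n])
  then have "lo * qform A w \<le> t * qform A w" "t * qform A w \<le> hi * qform A w"
    using b A t(1) by (auto simp: energy_bounds_def)
  then show "lo \<le> t" "t \<le> hi" using spdD(2)[OF A(2,1) t(1,2)] by auto
qed

lemma minimal_eigenvector:
  assumes A: "A \<in> carrier_mat n n" "spd A" and T: "T \<in> carrier_mat n n" "symmetric_mat (A * T)" and n: "0 < n"
  obtains t w where "w \<in> carrier_vec n" "w \<noteq> 0\<^sub>v n" "T *\<^sub>v w = t \<cdot>\<^sub>v w"
    "\<And>v. v \<in> carrier_vec n \<Longrightarrow> t * qform A v \<le> qform (A * T) v"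
proof -
  have AT: "A * T \<in> carrier_mat n n" using A T by simp
  obtain t w where w: "w \<in> carrier_vec n" "w \<noteq> 0\<^sub>v n" "(A * T) *\<^sub>v w = t \<cdot>\<^sub>v (A *\<^sub>v w)"
    and t: "\<And>v. v \<in> carrier_vec n \<Longrightarrow> t * qform A v \<le> qform (A * T) v"
    using rayleigh_minimum[OF A AT T(2) n] by blast
  have "A *\<^sub>v (T *\<^sub>v w) = t \<cdot>\<^sub>v (A *\<^sub>v w)"
    using A T w by (simp add: assoc_mult_mat_vec[of _ n n _ n])
  then have "A *\<^sub>v (T *\<^sub>v w - t \<cdot>\<^sub>v w) = 0\<^sub>v n"
    using A T w(1) by (simp add: mult_minus_distrib_mat_vec[of _ n n] mult_mat_vec[of _ n n])
  then have 0: "T *\<^sub>v w - t \<cdot>\<^sub>v w = 0\<^sub>v n"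
    using spd_kernel_trivial[OF A, of "T *\<^sub>v w - t \<cdot>\<^sub>v w"] T w by simp
  have "T *\<^sub>v w = t \<cdot>\<^sub>v w"
  proof (rule eq_vecI)
    fix i assume "i < dim_vec (t \<cdot>\<^sub>v w)"
    then show "(T *\<^sub>v w) $ i = (t \<cdot>\<^sub>v w) $ i"
      using arg_cong[OF 0, of "\<lambda>x. x $ i"] T w by simp
  qed (use T w in simp)
  then show ?thesis using that w t by blast
qed

lemma energy_lower_of_eigenvalues:
  assumes A: "A \<in> carrier_mat n n" "spd A" and T: "T \<in> carrier_mat n n" "symmetric_mat (A * T)" and n: "0 < n"
    and ev: "\<And>t. eigenvalue T t \<Longrightarrow> c \<le> t" and v: "v \<in> carrier_vec n"
  shows "c * qform A v \<le> qform (A * T) v"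
proof -
  obtain t w where w: "w \<in> carrier_vec n" "w \<noteq> 0\<^sub>v n" "T *\<^sub>v w = t \<cdot>\<^sub>v w"
    and t: "t * qform A v \<le> qform (A * T) v"
    using minimal_eigenvector[OF A T n] v by metis
  have "eigenvalue T t" using w T by (auto simp: eigenvalue_def eigenvector_def)
  then have "c * qform A v \<le> t * qform A v" using ev spdD(3)[OF A(2,1) v] by (intro mult_right_mono) auto
  then show ?thesis using t by linarith
qed

lemma energy_upper_of_eigenvalues:
  assumes A: "A \<in> carrier_mat n n" "spd A" and T: "T \<in> carrier_mat n n" "symmetric_mat (A * T)" and n: "0 < n"
    and ev: "\<And>t. eigenvalue T t \<Longrightarrow> t \<le> c" and v: "v \<in> carrier_vec n"
  shows "qform (A * T) v \<le> c * qform A v"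
proof -
  let ?N = "(-1) \<cdot>\<^sub>m T"
  have N: "?N \<in> carrier_mat n n" using T by simp
  have AN: "A * ?N = (-1) \<cdot>\<^sub>m (A * T)" using A T by (simp add: mult_smult_distrib[of _ n n _ n])
  have "- c * qform A v \<le> qform (A * ?N) v"
  proof (rule energy_lower_of_eigenvalues[OF A N _ n _ v])
    show "symmetric_mat (A * ?N)" using T(2) unfolding AN by (simp add: symmetric_mat_def transpose_smult_mat)
    fix t assume "eigenvalue ?N t"
    then obtain w where w: "w \<in> carrier_vec n" "w \<noteq> 0\<^sub>v n" "?N *\<^sub>v w = t \<cdot>\<^sub>v w"
      using T by (auto simp: eigenvalue_def eigenvector_def)
    have "T *\<^sub>v w = (-1) \<cdot>\<^sub>v (?N *\<^sub>v w)"
      using T w(1) by (simp add: smult_mat_mult_vec[of _ n n] smult_smult_assoc)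
    then have "T *\<^sub>v w = (- t) \<cdot>\<^sub>v w" by (simp add: w(3) smult_smult_assoc)
    then have "eigenvalue T (- t)" using w(1,2) T by (auto simp: eigenvalue_def eigenvector_def)
    then show "- c \<le> t" using ev by fastforce
  qed
  then show ?thesis using A T v unfolding AN by (simp add: qform_smult[of _ n])
qed

lemma energy_bounds_of_spectrum:
  assumes A: "A \<in> carrier_mat n n" "spd A" and T: "T \<in> carrier_mat n n" "symmetric_mat (A * T)" and n: "0 < n"
    and "lo \<le> lambda_min T" "lambda_max T \<le> hi"
  shows "energy_bounds A T lo hi"
proof -
  have fin: "finite (spectrum T)" using card_finite_spectrum[OF T(1)] by simp
  have "lo \<le> t" "t \<le> hi" if "eigenvalue T t" for t
  proof -
    have t: "t \<in> spectrum T" using that by (simp add: spectrum_def)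
    have "lambda_min T \<le> t" unfolding lambda_min_def by (rule Min_le[OF fin t])
    moreover have "t \<le> lambda_max T" unfolding lambda_max_def by (rule Max_ge[OF fin t])
    ultimately show "lo \<le> t" "t \<le> hi" using assms(6,7) by linarith+
  qed
  then show ?thesis
    using energy_lower_of_eigenvalues[OF A T n] energy_upper_of_eigenvalues[OF A T n] A
    by (auto simp: energy_bounds_def)
qed

text \<open>
  The extreme eigenvalues are a minimum and a maximum over the real spectrum, whose nonemptiness
  is supplied by the minimizer of the Rayleigh quotient.
\<close>

lemma cond_le_of_energy_bounds:
  assumes A: "A \<in> carrier_mat n n" "spd A" and T: "T \<in> carrier_mat n n" "symmetric_mat (A * T)" and n: "0 < n"
    and b: "energy_bounds A T lo hi" and lo: "0 < lo"
  shows "cond_le T (hi / lo)"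
proof -
  have ev: "lo \<le> t" "t \<le> hi" if ev: "eigenvalue T t" for t
  proof -
    obtain w where "w \<in> carrier_vec n" "w \<noteq> 0\<^sub>v n" "T *\<^sub>v w = t \<cdot>\<^sub>v w"
      using ev T by (auto simp: eigenvalue_def eigenvector_def)
    from eigenvalue_in_energy_bounds[OF A T(1) b this] show "lo \<le> t" "t \<le> hi" .
  qed
  have fin: "finite (spectrum T)" using card_finite_spectrum[OF T(1)] by simp
  obtain t w where "w \<in> carrier_vec n" "w \<noteq> 0\<^sub>v n" "T *\<^sub>v w = t \<cdot>\<^sub>v w"
    using minimal_eigenvector[OF A T n] by metis
  then have t: "eigenvalue T t" using T by (auto simp: eigenvalue_def eigenvector_def)
  then have ne: "spectrum T \<noteq> {}" by (auto simp: spectrum_def)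
  have min: "lo \<le> lambda_min T" unfolding lambda_min_def using fin ne ev(1) by (simp add: spectrum_def)
  have max: "lambda_max T \<le> hi" unfolding lambda_max_def using fin ne ev(2) by (simp add: spectrum_def)
  have "hi / lo * lo \<le> hi / lo * lambda_min T"
    using min ev[OF t] lo by (intro mult_left_mono) auto
  then have "lambda_max T \<le> hi / lo * lambda_min T" using max lo by simp
  moreover have "z \<in> \<real> \<and> 0 < Re z" if "z \<in> spectrum (map_mat complex_of_real T)" for z
    using eigenvalue_real_of_selfadjoint[OF A T, of z] ev(1)[of "Re z"] lo that
    by (auto simp: spectrum_def complex_is_Real_iff)
  ultimately show ?thesis by (simp add: cond_le_def)
qed

section \<open>Polynomials of a self-adjoint matrix\<close>

lemma dim_poly_mat [simp]: "dim_row (poly_mat p X) = dim_row X" "dim_col (poly_mat p X) = dim_row X"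
  by (simp_all add: poly_mat_def)

lemma poly_mat_carrier: "X \<in> carrier_mat n n \<Longrightarrow> poly_mat p X \<in> carrier_mat n n"
  by (simp add: poly_mat_def)

lemma poly_mat_index:
  assumes "X \<in> carrier_mat n n" "i < n" "j < n" "degree p \<le> N"
  shows "poly_mat p X $$ (i, j) = (\<Sum>k\<le>N. coeff p k * (X ^\<^sub>m k) $$ (i, j))"
proof -
  have "(\<Sum>k\<le>degree p. coeff p k * (X ^\<^sub>m k) $$ (i, j)) = (\<Sum>k\<le>N. coeff p k * (X ^\<^sub>m k) $$ (i, j))"
    using assms(4) by (intro sum.mono_neutral_left) (auto simp: coeff_eq_0)
  then show ?thesis using assms by (simp add: poly_mat_def)
qed

lemma poly_mat_pCons:
  assumes X: "X \<in> carrier_mat n n"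
  shows "poly_mat (pCons c p) X = c \<cdot>\<^sub>m 1\<^sub>m n + poly_mat p X * X"
proof (rule eq_matI)
  fix i j assume "i < dim_row (c \<cdot>\<^sub>m 1\<^sub>m n + poly_mat p X * X)" "j < dim_col (c \<cdot>\<^sub>m 1\<^sub>m n + poly_mat p X * X)"
  then have ij: "i < n" "j < n" using X by auto
  have "poly_mat (pCons c p) X $$ (i, j)
      = (\<Sum>k\<le>Suc (degree p). coeff (pCons c p) k * (X ^\<^sub>m k) $$ (i, j))"
    by (rule poly_mat_index[OF X ij degree_pCons_le])
  also have "\<dots> = c * (1\<^sub>m n) $$ (i, j) + (\<Sum>k\<le>degree p. coeff p k * (X ^\<^sub>m k * X) $$ (i, j))"
    using X by (subst sum.atMost_Suc_shift) simp
  also have "(\<Sum>k\<le>degree p. coeff p k * (X ^\<^sub>m k * X) $$ (i, j))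
      = (\<Sum>k\<le>degree p. \<Sum>l<n. coeff p k * (X ^\<^sub>m k) $$ (i, l) * X $$ (l, j))"
    using X ij by (intro sum.cong refl)
      (simp add: scalar_prod_def row_def col_def lessThan_atLeast0 sum_distrib_left mult.assoc)
  also have "\<dots> = (\<Sum>l<n. poly_mat p X $$ (i, l) * X $$ (l, j))"
    by (subst sum.swap) (simp add: sum_distrib_right poly_mat_index[OF X ij(1) _ order_refl])
  also have "\<dots> = (poly_mat p X * X) $$ (i, j)"
    using X ij poly_mat_carrier[OF X, of p]
    by (simp add: scalar_prod_def row_def col_def lessThan_atLeast0)
  finally show "poly_mat (pCons c p) X $$ (i, j) = (c \<cdot>\<^sub>m 1\<^sub>m n + poly_mat p X * X) $$ (i, j)"
    using X ij poly_mat_carrier[OF X, of p] by simp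
qed (use X in \<open>auto simp: poly_mat_def\<close>)

lemma poly_mat_0:
  assumes "X \<in> carrier_mat n n"
  shows "poly_mat 0 X = 0\<^sub>m n n"
  using assms by (auto intro!: eq_matI simp: poly_mat_def)

lemma poly_mat_const:
  assumes X: "X \<in> carrier_mat n n"
  shows "poly_mat [:c:] X = c \<cdot>\<^sub>m 1\<^sub>m n"
  using X by (simp add: poly_mat_pCons[OF X] poly_mat_0[OF X])

lemma poly_mat_linear:
  assumes X: "X \<in> carrier_mat n n"
  shows "poly_mat [:c, 1:] X = c \<cdot>\<^sub>m 1\<^sub>m n + X"
proof -
  have "(1 :: real) \<cdot>\<^sub>m 1\<^sub>m n = 1\<^sub>m n" by (auto intro!: eq_matI)
  then show ?thesis using X by (simp add: poly_mat_pCons[OF X, of c] poly_mat_const[OF X])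
qed

lemma poly_mat_add:
  assumes X: "X \<in> carrier_mat n n"
  shows "poly_mat (p + q) X = poly_mat p X + poly_mat q X"
proof (rule eq_matI)
  fix i j assume "i < dim_row (poly_mat p X + poly_mat q X)" "j < dim_col (poly_mat p X + poly_mat q X)"
  then have ij: "i < n" "j < n" using X by (auto simp: poly_mat_def)
  let ?N = "max (degree p) (degree q)"
  show "poly_mat (p + q) X $$ (i, j) = (poly_mat p X + poly_mat q X) $$ (i, j)"
    using poly_mat_index[OF X ij, of "p + q" ?N] poly_mat_index[OF X ij, of p ?N]
      poly_mat_index[OF X ij, of q ?N] X ij degree_add_le_max[of p q]
    by (simp add: sum.distrib distrib_right)
qed (use X in \<open>auto simp: poly_mat_def\<close>)

lemma poly_mat_smult:
  assumes X: "X \<in> carrier_mat n n"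
  shows "poly_mat (Polynomial.smult c p) X = c \<cdot>\<^sub>m poly_mat p X"
proof (rule eq_matI)
  fix i j assume "i < dim_row (c \<cdot>\<^sub>m poly_mat p X)" "j < dim_col (c \<cdot>\<^sub>m poly_mat p X)"
  then have ij: "i < n" "j < n" using X by (auto simp: poly_mat_def)
  show "poly_mat (Polynomial.smult c p) X $$ (i, j) = (c \<cdot>\<^sub>m poly_mat p X) $$ (i, j)"
    using poly_mat_index[OF X ij degree_smult_le[of c p]] poly_mat_index[OF X ij order_refl[of "degree p"]] X ij
    by (simp add: sum_distrib_left mult.assoc)
qed (use X in \<open>auto simp: poly_mat_def\<close>)

lemma poly_mat_commute:
  assumes X: "X \<in> carrier_mat n n"
  shows "X * poly_mat p X = poly_mat p X * X"
proof (induction p)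
  case 0
  then show ?case using X by (simp add: poly_mat_0)
next
  case (pCons c p)
  note P = poly_mat_carrier[OF X, of p]
  have "X * (c \<cdot>\<^sub>m 1\<^sub>m n + poly_mat p X * X) = c \<cdot>\<^sub>m X + (X * poly_mat p X) * X"
    using X P by (simp add: mult_add_distrib_mat[of _ n n _ n] mult_smult_distrib[of _ n n _ n]
        assoc_mult_mat[of _ n n _ n _ n])
  also have "\<dots> = (c \<cdot>\<^sub>m 1\<^sub>m n + poly_mat p X * X) * X"
    using X P by (simp add: pCons add_mult_distrib_mat[of _ n n _ _ n] mult_smult_assoc_mat[of _ n n _ n])
  finally show ?case by (simp add: poly_mat_pCons[OF X])
qed

lemma poly_mat_mult:
  assumes X: "X \<in> carrier_mat n n"
  shows "poly_mat (p * q) X = poly_mat p X * poly_mat q X"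
proof (induction p)
  case 0
  then show ?case using X poly_mat_carrier[OF X, of q] by (simp add: poly_mat_0)
next
  case (pCons c p)
  note P = poly_mat_carrier[OF X, of p] and Q = poly_mat_carrier[OF X, of q]
  let ?Q = "poly_mat q X" and ?P = "poly_mat p X"
  have "0 \<cdot>\<^sub>m 1\<^sub>m n = (0\<^sub>m n n :: real mat)" by (auto intro!: eq_matI)
  then have "poly_mat (pCons c p * q) X = c \<cdot>\<^sub>m ?Q + ?P * ?Q * X"
    using X P Q by (simp add: poly_mat_add poly_mat_smult poly_mat_pCons pCons
        left_add_zero_mat[of _ n n] mult_carrier_mat[of _ n n _ n])
  also have "?P * ?Q * X = ?P * X * ?Q"
    using X P Q by (simp add: assoc_mult_mat[of _ n n _ n _ n] poly_mat_commute)
  also have "c \<cdot>\<^sub>m ?Q + ?P * X * ?Q = (c \<cdot>\<^sub>m 1\<^sub>m n + ?P * X) * ?Q"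
    using X P Q by (simp add: add_mult_distrib_mat[of _ n n _ _ n] mult_smult_assoc_mat[of _ n n _ n])
  finally show ?case by (simp add: poly_mat_pCons[OF X])
qed

lemma symmetric_poly_mat:
  assumes A: "A \<in> carrier_mat n n" "symmetric_mat A" and T: "T \<in> carrier_mat n n" "symmetric_mat (A * T)"
  shows "symmetric_mat (A * poly_mat p T)"
proof (induction p)
  case 0
  then show ?case using A T by (simp add: poly_mat_0 symmetric_mat_def)
next
  case (pCons c p)
  let ?P = "poly_mat p T"
  have P: "?P \<in> carrier_mat n n" by (rule poly_mat_carrier[OF T(1)])
  have e: "A * poly_mat (pCons c p) T = c \<cdot>\<^sub>m A + A * ?P * T"
    using A T P by (simp add: poly_mat_pCons mult_add_distrib_mat[of _ n n _ n]
        mult_smult_distrib[of _ n n _ n] assoc_mult_mat[of _ n n _ n _ n])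
  have TA: "transpose_mat T * A = A * T"
    using A T transpose_mult[of A n n T n] by (simp add: symmetric_mat_def)
  have "transpose_mat (A * ?P * T) = transpose_mat T * (A * ?P)"
    using A T P pCons transpose_mult[of "A * ?P" n n T n] by (simp add: symmetric_mat_def)
  also have "\<dots> = A * T * ?P"
    using A T P by (subst assoc_mult_mat[of _ n n _ n _ n, symmetric]) (auto simp: TA)
  also have "\<dots> = A * ?P * T"
    using A T P by (simp add: assoc_mult_mat[of _ n n _ n _ n] poly_mat_commute)
  finally have "transpose_mat (A * ?P * T) = A * ?P * T" .
  then show ?case
    using A T P by (simp add: e symmetric_mat_def transpose_add[of _ n n] transpose_smult_mat)
qed

lemma poly_mat_linear_mult_vec:
  assumes T: "T \<in> carrier_mat n n" and w: "w \<in> carrier_vec n"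
  shows "poly_mat [:-r, 1:] T *\<^sub>v w = T *\<^sub>v w - r \<cdot>\<^sub>v w"
proof -
  have "poly_mat [:-r, 1:] T *\<^sub>v w = - r \<cdot>\<^sub>v w + T *\<^sub>v w"
    using T w by (simp add: poly_mat_linear add_mult_distrib_mat_vec[of _ n n]
        smult_mat_mult_vec[of _ n n])
  also have "\<dots> = T *\<^sub>v w - r \<cdot>\<^sub>v w" using T w by (auto intro!: eq_vecI)
  finally show ?thesis .
qed

text \<open>
  The quadratic is \<open>(x - z) (x - cnj z)\<close>, written as a sum of squares because its positivity is what
  is used below. The remainder modulo it is a real polynomial of degree at most one with a nonreal
  root, hence zero.
\<close>

lemma quadratic_dvd_of_nonreal_root:
  fixes f :: "real poly"
  assumes root: "poly (map_poly complex_of_real f) z = 0" and im: "Im z \<noteq> 0"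
  shows "[:-Re z, 1:]\<^sup>2 + [:(Im z)\<^sup>2:] dvd f"
proof -
  interpret hom: map_poly_idom_hom complex_of_real ..
  define h where "h = [:-Re z, 1:]\<^sup>2 + [:(Im z)\<^sup>2:]"
  have h: "h = [:(Re z)\<^sup>2 + (Im z)\<^sup>2, - 2 * Re z, 1:]"
    by (simp add: h_def power2_eq_square)
  have "poly (map_poly complex_of_real h) z = 0"
    by (simp add: h map_poly_pCons complex_eq_iff power2_eq_square algebra_simps)
  then have "poly (map_poly complex_of_real (f mod h)) z = 0"
    using root arg_cong[OF div_mult_mod_eq[of f h], of "\<lambda>p. poly (map_poly complex_of_real p) z"]
    by (simp only: hom.hom_add hom.hom_mult poly_add poly_mult) simp
  moreover have "degree (f mod h) < 2"
    using degree_mod_less[of h f] by (auto simp: h)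
  then have "f mod h = [:coeff (f mod h) 0, coeff (f mod h) 1:]"
    by (intro poly_eqI) (auto simp: coeff_pCons coeff_eq_0 split: nat.split)
  then obtain b c where bc: "f mod h = [:b, c:]" by blast
  moreover have "map_poly complex_of_real [:b, c:] = [:complex_of_real b, complex_of_real c:]"
    by (rule poly_eqI) (simp add: coeff_map_poly coeff_pCons split: nat.split)
  ultimately have "complex_of_real b + z * complex_of_real c = 0" by simp
  then have "b = 0 \<and> c = 0" using im by (auto simp: complex_eq_iff)
  then show ?thesis using bc by (simp add: h_def[symmetric] dvd_eq_mod_eq_0)
qed

text \<open>
  The core of spectral mapping, by induction on the degree over real factors of \<open>f\<close>. A factor
  \<open>x - r\<close> either annihilates \<open>w\<close>, so that \<open>r\<close> is an eigenvalue of \<open>T\<close> and lies in the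
  interval, or it sends \<open>w\<close> to a nonzero vector that the remaining factor annihilates. A factor
  \<open>(x - \<alpha>)\<^sup>2 + \<beta>\<^sup>2\<close> with \<open>\<beta> \<noteq> 0\<close> is always of the second kind, because its form at \<open>w\<close> is the energy of
  \<open>(T - \<alpha>) w\<close> plus \<open>\<beta>\<^sup>2\<close> times the energy of \<open>w\<close>.
\<close>

lemma root_in_bounds_of_kernel:
  assumes A: "A \<in> carrier_mat n n" "spd A" and T: "T \<in> carrier_mat n n" "symmetric_mat (A * T)"
    and b: "energy_bounds A T lo hi" and lohi: "lo \<le> hi"
  shows "w \<in> carrier_vec n \<Longrightarrow> w \<noteq> 0\<^sub>v n \<Longrightarrow> poly_mat f T *\<^sub>v w = 0\<^sub>v n
    \<Longrightarrow> \<exists>r \<in> {lo..hi}. poly f r = 0"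
proof (induction "degree f" arbitrary: f w rule: less_induct)
  case less
  note w = less.prems(1,2)
  show ?case
  proof (cases "degree f = 0")
    case True
    then obtain c where f: "f = [:c:]" by (rule degree_eq_zeroE)
    have "c \<cdot>\<^sub>v w = 0\<^sub>v n"
      using less.prems(3) T w by (simp add: f poly_mat_const smult_mat_mult_vec[of _ n n])
    then have "c = 0" using w by (auto simp: vec_eq_iff)
    then show ?thesis using lohi by (auto simp: f)
  next
    case False
    have split: "poly_mat g T *\<^sub>v (poly_mat h T *\<^sub>v w) = 0\<^sub>v n" if "f = h * g" for g h
    proof -
      have "f = g * h" using that by (simp add: mult.commute)
      then show ?thesis
        using less.prems(3) T w poly_mat_carrier[OF T(1), of g] poly_mat_carrier[OF T(1), of h]
        by (simp add: poly_mat_mult assoc_mult_mat_vec[of _ n n _ n])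
    qed
    have descend: "\<exists>r \<in> {lo..hi}. poly f r = 0"
      if f: "f = h * g" and d: "0 < degree h" and nz: "poly_mat h T *\<^sub>v w \<noteq> 0\<^sub>v n" for g h
    proof -
      have "f \<noteq> 0" using False by auto
      then have "degree g < degree f" using d f by (simp add: degree_mult_eq)
      moreover have "poly_mat h T *\<^sub>v w \<in> carrier_vec n"
        using poly_mat_carrier[OF T(1), of h] w by simp
      ultimately have "\<exists>r \<in> {lo..hi}. poly g r = 0"
        using less.hyps[of g "poly_mat h T *\<^sub>v w"] split[OF f] nz by blast
      then show ?thesis by (auto simp: f)
    qed
    have "degree (map_poly complex_of_real f) = degree f" by (rule degree_map_poly) simp
    with False have "\<not> (\<exists>a l. a \<noteq> 0 \<and> l = 0 \<and> map_poly complex_of_real f = pCons a l)"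
      by (metis degree_pCons_0)
    then obtain z where z: "poly (map_poly complex_of_real f) z = 0"
      using fundamental_theorem_of_algebra_alt by blast
    show ?thesis
    proof (cases "Im z = 0")
      case True
      define r where "r = Re z"
      have "z = complex_of_real r" using True by (simp add: r_def complex_eq_iff)
      then have "poly f r = 0" using z by simp
      then obtain g where f: "f = [:-r, 1:] * g" unfolding poly_eq_0_iff_dvd by (elim dvdE)
      show ?thesis
      proof (cases "poly_mat [:-r, 1:] T *\<^sub>v w = 0\<^sub>v n")
        case True
        then have 0: "T *\<^sub>v w - r \<cdot>\<^sub>v w = 0\<^sub>v n" using poly_mat_linear_mult_vec[OF T(1) w(1)] by simp
        have "T *\<^sub>v w = r \<cdot>\<^sub>v w"
        proof (rule eq_vecI)
          fix i assume "i < dim_vec (r \<cdot>\<^sub>v w)"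
          then show "(T *\<^sub>v w) $ i = (r \<cdot>\<^sub>v w) $ i"
            using arg_cong[OF 0, of "\<lambda>x. x $ i"] T w by simp
        qed (use T w in simp)
        then have "r \<in> {lo..hi}" using eigenvalue_in_energy_bounds[OF A T(1) b w] by simp
        then show ?thesis using \<open>poly f r = 0\<close> by blast
      next
        case False
        then show ?thesis using descend[OF f] by simp
      qed
    next
      case False
      define h where "h = [:-Re z, 1:]\<^sup>2 + [:(Im z)\<^sup>2:]"
      have "h dvd f" unfolding h_def by (rule quadratic_dvd_of_nonreal_root[OF z False])
      then obtain g where f: "f = h * g" by (elim dvdE)
      define y where "y = poly_mat [:-Re z, 1:] T *\<^sub>v w"
      note lin = poly_mat_carrier[OF T(1), of "[:-Re z, 1:]"]
      have y: "y \<in> carrier_vec n" using lin w by (simp add: y_def)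
      have zero_mult: "A *\<^sub>v 0\<^sub>v n = 0\<^sub>v n" using A by (auto intro!: eq_vecI)
      have hw: "poly_mat h T *\<^sub>v w = poly_mat [:-Re z, 1:] T *\<^sub>v y + (Im z)\<^sup>2 \<cdot>\<^sub>v w"
        unfolding h_def power2_eq_square[of "[:-Re z, 1:]"] poly_mat_add[OF T(1)] poly_mat_mult[OF T(1)]
          poly_mat_const[OF T(1)] y_def
        using lin w by (simp add: add_mult_distrib_mat_vec[of _ n n] assoc_mult_mat_vec[of _ n n _ n]
            smult_mat_mult_vec[of _ n n])
      have "(A *\<^sub>v (poly_mat h T *\<^sub>v w)) \<bullet> w = qform A y + (Im z)\<^sup>2 * qform A w"
      proof -
        have "(A *\<^sub>v (poly_mat [:-Re z, 1:] T *\<^sub>v y)) \<bullet> w = qform A y"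
          using selfadjoint_swap[OF A(1) spdD(1)[OF A(2,1)] lin symmetric_poly_mat[OF A(1) spdD(1)[OF A(2,1)] T] y w(1)]
          by (simp add: qform_def y_def)
        then show ?thesis
          using A lin w y unfolding hw
          by (simp add: mult_add_distrib_mat_vec[of _ n n] mult_mat_vec[of _ n n] qform_def
              add_scalar_prod_distrib[of _ n])
      qed
      also have "\<dots> > 0"
        using spdD(2)[OF A(2,1) w] spdD(3)[OF A(2,1) y] False by (simp add: add_nonneg_pos)
      finally have "poly_mat h T *\<^sub>v w \<noteq> 0\<^sub>v n"
        using A w by (auto simp: zero_mult)
      moreover have "0 < degree h" by (simp add: h_def power2_eq_square)
      ultimately show ?thesis using descend[OF f] by blast
    qed
  qed
qed

text \<open>
  An eigenvector of \<open>q(T)\<close> for \<open>t\<close> is a kernel vector of \<open>(q - t)(T)\<close>, so \<open>q - t\<close> has a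
  root between the energy bounds of \<open>T\<close>.
\<close>

lemma eigenvalue_poly_mat_in_image:
  assumes A: "A \<in> carrier_mat n n" "spd A" and T: "T \<in> carrier_mat n n" "symmetric_mat (A * T)" and n: "0 < n"
    and b: "energy_bounds A T lo hi" and ev: "eigenvalue (poly_mat q T) t"
  shows "\<exists>r \<in> {lo..hi}. t = poly q r"
proof -
  obtain s u where "u \<in> carrier_vec n" "u \<noteq> 0\<^sub>v n" "T *\<^sub>v u = s \<cdot>\<^sub>v u"
    using minimal_eigenvector[OF A T n] by metis
  from eigenvalue_in_energy_bounds[OF A T(1) b this] have lohi: "lo \<le> hi" by linarith
  obtain w where w: "w \<in> carrier_vec n" "w \<noteq> 0\<^sub>v n" "poly_mat q T *\<^sub>v w = t \<cdot>\<^sub>v w"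
    using ev T by (auto simp: eigenvalue_def eigenvector_def poly_mat_def)
  have "poly_mat (q + [:-t:]) T *\<^sub>v w = t \<cdot>\<^sub>v w + (- t) \<cdot>\<^sub>v w"
    using T w poly_mat_carrier[OF T(1), of q] by (simp add: poly_mat_add poly_mat_const add_mult_distrib_mat_vec[of _ n n]
        smult_mat_mult_vec[of _ n n])
  also have "\<dots> = 0\<^sub>v n" using w by (auto intro!: eq_vecI)
  finally obtain r where "r \<in> {lo..hi}" "poly (q + [:-t:]) r = 0"
    using root_in_bounds_of_kernel[OF A T b lohi w(1,2)] by blast
  then show ?thesis by (intro bexI[of _ r]) auto
qed

lemma energy_bounds_poly_mat:
  assumes A: "A \<in> carrier_mat n n" "spd A" and T: "T \<in> carrier_mat n n" "symmetric_mat (A * T)" and n: "0 < n"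
    and b: "energy_bounds A T lo hi"
    and q: "\<And>x. lo \<le> x \<Longrightarrow> x \<le> hi \<Longrightarrow> c \<le> poly q x \<and> poly q x \<le> d"
  shows "energy_bounds A (poly_mat q T) c d"
proof -
  note Q = poly_mat_carrier[OF T(1), of q] symmetric_poly_mat[OF A(1) spdD(1)[OF A(2,1)] T, of q]
  have "c \<le> t \<and> t \<le> d" if "eigenvalue (poly_mat q T) t" for t
    using eigenvalue_poly_mat_in_image[OF A T n b that] q by auto
  then show ?thesis
    using energy_lower_of_eigenvalues[OF A Q n] energy_upper_of_eigenvalues[OF A Q n] A
    by (auto simp: energy_bounds_def)
qed

section \<open>Smoothers and cycles\<close>

lemma minv_inverse:
  assumes A: "A \<in> carrier_mat n n" and D: "D \<in> carrier_mat n n" "A * D = 1\<^sub>m n" "D * A = 1\<^sub>m n"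
  shows "minv A \<in> carrier_mat n n" "A * minv A = 1\<^sub>m n" "minv A * A = 1\<^sub>m n"
proof -
  have "A \<in> Units (ring_mat TYPE(real) n ())"
    using A D by (auto simp: Units_def ring_mat_simps)
  then obtain B where "mat_inverse A = Some B"
    using mat_inverse(1)[OF A, of "()"] by (cases "mat_inverse A") auto
  then show "minv A \<in> carrier_mat n n" "A * minv A = 1\<^sub>m n" "minv A * A = 1\<^sub>m n"
    using mat_inverse(2)[OF A] by (auto simp: minv_def)
qed

lemma minv_invertible:
  assumes A: "A \<in> carrier_mat n n" "invertible_mat A"
  shows "minv A \<in> carrier_mat n n" "A * minv A = 1\<^sub>m n" "minv A * A = 1\<^sub>m n"
proof -
  obtain D where AD: "A * D = 1\<^sub>m n" and DA: "D * A = 1\<^sub>m (dim_row D)"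
    using A by (auto simp: invertible_mat_def inverts_mat_def)
  have "dim_col D = n" using arg_cong[OF AD, of dim_col] by simp
  moreover have "dim_row D = n" using arg_cong[OF DA, of dim_col] A by simp
  ultimately have D: "D \<in> carrier_mat n n" "D * A = 1\<^sub>m n" using DA by auto
  show "minv A \<in> carrier_mat n n" "A * minv A = 1\<^sub>m n" "minv A * A = 1\<^sub>m n"
    using minv_inverse[OF A(1) D(1) AD D(2)] .
qed

lemma minv_spd:
  assumes A: "A \<in> carrier_mat n n" "spd A"
  shows "minv A \<in> carrier_mat n n" "A * minv A = 1\<^sub>m n" "minv A * A = 1\<^sub>m n" "symmetric_mat (minv A)"
proof -
  obtain D where D: "D \<in> carrier_mat n n" "A * D = 1\<^sub>m n" "D * A = 1\<^sub>m n"
    using invertible_of_trivial_kernel[OF A(1) spd_kernel_trivial[OF A]] by blast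
  note inv = minv_inverse[OF A(1) D]
  show "minv A \<in> carrier_mat n n" "A * minv A = 1\<^sub>m n" "minv A * A = 1\<^sub>m n" using inv .
  let ?D = "minv A"
  have "transpose_mat ?D * A = 1\<^sub>m n"
    using transpose_mult[OF A(1) inv(1)] inv(2) spdD(1)[OF A(2,1)] by (simp add: symmetric_mat_def)
  then have "transpose_mat ?D * A * ?D = ?D" using inv(1) by simp
  moreover have "transpose_mat ?D * A * ?D = transpose_mat ?D"
    using A inv by (simp add: assoc_mult_mat[of _ n n _ n _ n])
  ultimately show "symmetric_mat ?D" by (simp add: symmetric_mat_def)
qed

text \<open>
  Any \<open>w\<close> can be written as \<open>A v\<close>, so energy bounds of \<open>B A\<close> compare the form of \<open>B\<close> at \<open>w\<close> with the
  form of the inverse of \<open>A\<close> at \<open>w\<close>, in which shape the levels are linked.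
\<close>

lemma qform_correction:
  assumes A: "A \<in> carrier_mat n n" "symmetric_mat A" and B: "B \<in> carrier_mat n n" and v: "v \<in> carrier_vec n"
  shows "qform (A * (B * A)) v = qform B (A *\<^sub>v v)"
  using qform_congruence[OF B A(1) v] A B
  by (simp add: symmetric_mat_def assoc_mult_mat[of _ n n _ n _ n])

lemma symmetric_correction:
  assumes A: "A \<in> carrier_mat n n" "symmetric_mat A" and B: "B \<in> carrier_mat n n" "symmetric_mat B"
  shows "symmetric_mat (A * (B * A))"
  using symmetric_mat_congruence[OF B A(1)] A B
  by (simp add: symmetric_mat_def[of A] assoc_mult_mat[of _ n n _ n _ n])

lemma symmetrized_smoother_eq:
  assumes A: "A \<in> carrier_mat n n" and M: "M \<in> carrier_mat n n" "invertible_mat M"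
  shows "symmetrized_smoother A M = transpose_mat M + M - transpose_mat M * A * M"
proof -
  note inv = minv_invertible[OF M]
  have 1: "transpose_mat M * minv M * M = transpose_mat M"
    using M inv by (simp add: assoc_mult_mat[of _ n n _ n _ n])
  have 2: "transpose_mat M * transpose_mat (minv M) = 1\<^sub>m n"
    using transpose_mult[OF inv(1) M(1)] inv(3) by simp
  have "symmetrized_smoother A M
      = (transpose_mat M * minv M + transpose_mat M * transpose_mat (minv M) - transpose_mat M * A) * M"
    unfolding symmetrized_smoother_def using A M inv
    by (simp add: mult_add_distrib_mat[of _ n n _ n] mult_minus_distrib_mat[of _ n n _ n])
  also have "\<dots> = transpose_mat M * minv M * M + 1\<^sub>m n * M - transpose_mat M * A * M"
    unfolding 2 using A M inv
    by (simp add: add_mult_distrib_mat[of _ n n _ _ n] minus_mult_distrib_mat[of _ n n _ _ n] del: left_mult_one_mat)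
  finally show ?thesis unfolding 1 using M by simp
qed

lemma symmetrized_smoother_symmetric:
  assumes A: "A \<in> carrier_mat n n" "symmetric_mat A" and M: "M \<in> carrier_mat n n" "invertible_mat M"
  shows "symmetrized_smoother A M \<in> carrier_mat n n" "symmetric_mat (symmetrized_smoother A M)"
proof -
  show "symmetrized_smoother A M \<in> carrier_mat n n"
    using A M by (simp add: symmetrized_smoother_eq[OF A(1) M] minus_carrier_mat)
  have "transpose_mat (transpose_mat M * A * M) = transpose_mat M * A * M"
    using symmetric_mat_congruence[OF A M(1)] by (simp add: symmetric_mat_def)
  then show "symmetric_mat (symmetrized_smoother A M)"
    using A M unfolding symmetrized_smoother_eq[OF A(1) M] symmetric_mat_def
    by (simp add: transpose_add[of _ n n] transpose_minus[of _ n n] comm_add_mat[of M n n])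
qed

text \<open>
  The energy removed by one smoothing step is the form of the symmetrized smoother at the residual:
  both sides equal \<open>2 (w, M w) - (A M w, M w)\<close> with \<open>w = A v\<close>.
\<close>

lemma qform_symmetrized_smoother:
  assumes A: "A \<in> carrier_mat n n" "symmetric_mat A" and M: "M \<in> carrier_mat n n" "invertible_mat M"
    and v: "v \<in> carrier_vec n"
  shows "qform (symmetrized_smoother A M) (A *\<^sub>v v) = qform A v - qform A ((1\<^sub>m n - M * A) *\<^sub>v v)"
proof -
  define w where "w = A *\<^sub>v v"
  define u where "u = M *\<^sub>v w"
  have w: "w \<in> carrier_vec n" and u: "u \<in> carrier_vec n" and Au: "A *\<^sub>v u \<in> carrier_vec n"
    using A M v by (auto simp: w_def u_def)
  have "(1\<^sub>m n - M * A) *\<^sub>v v = v - u"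
    using A M v by (simp add: minus_mult_distrib_mat_vec[of _ n n] u_def w_def)
  then have "qform A ((1\<^sub>m n - M * A) *\<^sub>v v) = w \<bullet> v - w \<bullet> u - (A *\<^sub>v u) \<bullet> v + qform A u"
    using A v u w Au by (simp add: qform_def mult_minus_distrib_mat_vec[of _ n n] w_def[symmetric]
        minus_scalar_prod_distrib[of _ n] scalar_prod_minus_distrib[of _ n])
  also have "(A *\<^sub>v u) \<bullet> v = w \<bullet> u" using scalar_prod_symmetric_mat[OF A u v] by (simp add: w_def)
  also have "w \<bullet> v = qform A v" by (simp add: qform_def w_def)
  finally have right: "qform A ((1\<^sub>m n - M * A) *\<^sub>v v) = qform A v - 2 * (w \<bullet> u) + qform A u" by simp
  have "qform (transpose_mat M) w = w \<bullet> u"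
    using scalar_prod_transpose[of "transpose_mat M" n n w w] M w by (simp add: qform_def u_def)
  moreover have "qform M w = w \<bullet> u" using comm_scalar_prod[OF w u] by (simp add: qform_def u_def)
  moreover have "qform (transpose_mat M * A * M) w = qform A u"
    using qform_congruence[OF A(1) M(1) w] by (simp add: u_def)
  ultimately have "qform (symmetrized_smoother A M) w = 2 * (w \<bullet> u) - qform A u"
    using A M w by (simp add: symmetrized_smoother_eq[OF A(1) M] qform_add[of _ n] qform_minus[of _ n])
  then show ?thesis using right by (simp add: w_def)
qed

text \<open>
  The supremum bounds its members only if it is taken over a bounded set. Boundedness comes from the
  two estimates \<open>(A E u, E u) \<le> K (u, u)\<close> and \<open>\<epsilon> (u, u) \<le> (A u, u)\<close>.
\<close>

lemma qform_le_of_energy_onorm_le_1: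
  assumes A: "A \<in> carrier_mat n n" "spd A" and E: "E \<in> carrier_mat n n"
    and norm: "energy_onorm A E \<le> 1" and v: "v \<in> carrier_vec n"
  shows "qform A (E *\<^sub>v v) \<le> qform A v"
proof (cases "v = 0\<^sub>v n")
  case True
  have "E *\<^sub>v 0\<^sub>v n = 0\<^sub>v n" using E by (auto intro!: eq_vecI)
  then show ?thesis using True by simp
next
  case False
  let ?ratio = "\<lambda>v. energy_norm A (E *\<^sub>v v) / energy_norm A v"
  let ?V = "{v \<in> carrier_vec (dim_row A). v \<noteq> 0\<^sub>v (dim_row A)}"
  obtain \<epsilon> where \<epsilon>: "\<epsilon> > 0" "\<And>v. v \<in> carrier_vec n \<Longrightarrow> \<epsilon> * (v \<bullet> v) \<le> qform A v"
    using spd_coercive[OF A] by blast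
  have EAE: "transpose_mat E * A * E \<in> carrier_mat n n" using A E by simp
  obtain K where K: "K > 0" "\<And>v. v \<in> carrier_vec n \<Longrightarrow> \<bar>qform (transpose_mat E * A * E) v\<bar> \<le> K * (v \<bullet> v)"
    using qform_bounded[OF EAE] by blast
  have "?ratio u \<le> sqrt (K / \<epsilon>)" if "u \<in> ?V" for u
  proof -
    have u: "u \<in> carrier_vec n" "u \<noteq> 0\<^sub>v n" using that A by auto
    have "qform A (E *\<^sub>v u) \<le> K * (u \<bullet> u)"
      using K(2)[OF u(1)] qform_congruence[OF A(1) E u(1)] by linarith
    also have "\<dots> \<le> K / \<epsilon> * qform A u" using \<epsilon>(1) \<epsilon>(2)[OF u(1)] K(1) by (simp add: field_simps)
    finally have "qform A (E *\<^sub>v u) / qform A u \<le> K / \<epsilon>"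
      using spdD(2)[OF A(2,1) u] by (simp add: divide_le_eq)
    then show ?thesis by (simp add: energy_norm_def qform_def real_sqrt_divide[symmetric])
  qed
  then have "bdd_above (?ratio ` ?V)" by (intro bdd_aboveI2)
  moreover have "v \<in> ?V" using v False A by simp
  ultimately have "?ratio v \<le> energy_onorm A E" unfolding energy_onorm_def by (intro cSUP_upper)
  then have "sqrt (qform A (E *\<^sub>v v)) / sqrt (qform A v) \<le> 1"
    using norm by (simp add: energy_norm_def qform_def)
  then show ?thesis using spdD(2)[OF A(2,1) v False] by (simp add: divide_le_eq)
qed

lemma symmetrized_smoother_nonneg:
  assumes A: "A \<in> carrier_mat n n" "spd A" and M: "M \<in> carrier_mat n n" "invertible_mat M"
    and norm: "energy_onorm A (1\<^sub>m n - M * A) \<le> 1" and v: "v \<in> carrier_vec n"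
  shows "0 \<le> qform (symmetrized_smoother A M) (A *\<^sub>v v)"
  using qform_symmetrized_smoother[OF A(1) spdD(1)[OF A(2,1)] M v]
    qform_le_of_energy_onorm_le_1[OF A _ norm v] A M by (simp add: minus_carrier_mat)

text \<open>
  By symmetry of \<open>A\<close> the coarse correction is a congruence transform of \<open>C\<close>, by the map that takes
  the fine residual to the restricted residual after smoothing.
\<close>

lemma cycle_op_eq:
  assumes A: "A \<in> carrier_mat n n" "symmetric_mat A" and M: "M \<in> carrier_mat n n"
    and P: "P \<in> carrier_mat n m" and C: "C \<in> carrier_mat m m"
  shows "cycle_op A M P C = symmetrized_smoother A M +
    transpose_mat (transpose_mat P * (1\<^sub>m n - A * M)) * C * (transpose_mat P * (1\<^sub>m n - A * M))"
proof -
  have "transpose_mat (transpose_mat P * (1\<^sub>m n - A * M)) = transpose_mat (1\<^sub>m n - A * M) * P"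
    using transpose_mult[of "transpose_mat P" m n "1\<^sub>m n - A * M" n] A M P
    by (simp add: minus_carrier_mat)
  also have "transpose_mat (1\<^sub>m n - A * M) = 1\<^sub>m n - transpose_mat M * A"
    using transpose_minus[of "1\<^sub>m n" n n "A * M"] transpose_mult[OF A(1) M] A M
    by (simp add: symmetric_mat_def)
  finally have Y: "transpose_mat (transpose_mat P * (1\<^sub>m n - A * M)) = (1\<^sub>m n - transpose_mat M * A) * P" .
  let ?X = "1\<^sub>m n - transpose_mat M * A" and ?Z = "1\<^sub>m n - A * M"
  have X: "?X \<in> carrier_mat n n" and Z: "?Z \<in> carrier_mat n n"
    using A M by (auto intro: minus_carrier_mat)
  have XP: "?X * P \<in> carrier_mat n m" using X P by simp
  have "?X * P * C * transpose_mat P * ?Z = ?X * P * C * (transpose_mat P * ?Z)"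
    using XP P C Z by (intro assoc_mult_mat[of _ n m _ n _ n]) auto
  then show ?thesis unfolding cycle_op_def Y using A by simp
qed

lemma cycle_op_symmetric:
  assumes A: "A \<in> carrier_mat n n" "symmetric_mat A" and M: "M \<in> carrier_mat n n" "invertible_mat M"
    and P: "P \<in> carrier_mat n m" and C: "C \<in> carrier_mat m m" "symmetric_mat C"
  shows "cycle_op A M P C \<in> carrier_mat n n" "symmetric_mat (cycle_op A M P C)"
proof -
  let ?Y = "transpose_mat P * (1\<^sub>m n - A * M)"
  have Y: "?Y \<in> carrier_mat m n" using A M P by (simp add: minus_carrier_mat)
  have YCY: "transpose_mat ?Y * C * ?Y \<in> carrier_mat n n" using Y C by simp
  note S = symmetrized_smoother_symmetric[OF A M]
  show "cycle_op A M P C \<in> carrier_mat n n"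
    unfolding cycle_op_eq[OF A M(1) P C(1)] using S(1) YCY by simp
  show "symmetric_mat (cycle_op A M P C)"
    using symmetric_mat_congruence[OF C Y] S YCY transpose_add[OF S(1) YCY]
    by (simp only: cycle_op_eq[OF A M(1) P C(1)] symmetric_mat_def)
qed

lemma qform_cycle_op:
  assumes A: "A \<in> carrier_mat n n" "symmetric_mat A" and M: "M \<in> carrier_mat n n" "invertible_mat M"
    and P: "P \<in> carrier_mat n m" and C: "C \<in> carrier_mat m m" and w: "w \<in> carrier_vec n"
  shows "qform (cycle_op A M P C) w
    = qform (symmetrized_smoother A M) w + qform C ((transpose_mat P * (1\<^sub>m n - A * M)) *\<^sub>v w)"
proof -
  let ?Y = "transpose_mat P * (1\<^sub>m n - A * M)"
  have Y: "?Y \<in> carrier_mat m n" using A M P by (simp add: minus_carrier_mat)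
  have YCY: "transpose_mat ?Y * C * ?Y \<in> carrier_mat n n" using Y C by simp
  show ?thesis
    unfolding cycle_op_eq[OF A M(1) P C]
    using qform_add[OF symmetrized_smoother_symmetric(1)[OF A M] YCY w] qform_congruence[OF C Y w] by simp
qed

text \<open>
  Write \<open>s \<ge> 0\<close> for the smoother part and \<open>g\<close> for the exact coarse correction, so that the
  two-grid form is \<open>s + g\<close>. Replacing the exact coarse solver by \<open>C\<close> gives a form between
  \<open>s + lo g\<close> and \<open>s + hi g\<close>, hence between \<open>lo (s + g)\<close> and \<open>hi (s + g)\<close> because \<open>lo \<le> 1 \<le> hi\<close>.
\<close>

lemma cycle_op_energy_bounds:
  assumes A: "A \<in> carrier_mat n n" "spd A" and M: "M \<in> carrier_mat n n" "invertible_mat M"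
    and norm: "energy_onorm A (1\<^sub>m n - M * A) \<le> 1"
    and P: "P \<in> carrier_mat n m" and Ac: "Ac \<in> carrier_mat m m" "spd Ac"
    and C: "C \<in> carrier_mat m m" "symmetric_mat C" "energy_bounds Ac (C * Ac) lo hi" and lohi: "0 \<le> lo" "lo \<le> 1" "1 \<le> hi"
    and tg: "energy_bounds A (cycle_op A M P (minv Ac) * A) c 1"
  shows "energy_bounds A (cycle_op A M P C * A) (lo * c) hi"
proof -
  note symA = spdD(1)[OF A(2,1)] and symAc = spdD(1)[OF Ac(2,1)] and Ai = minv_spd[OF Ac]
  note cyc = cycle_op_symmetric(1)[OF A(1) symA M P]
  have "lo * c * qform A v \<le> qform (A * (cycle_op A M P C * A)) v
      \<and> qform (A * (cycle_op A M P C * A)) v \<le> hi * qform A v" if v: "v \<in> carrier_vec n" for v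
  proof -
    define w where "w = A *\<^sub>v v"
    define y where "y = (transpose_mat P * (1\<^sub>m n - A * M)) *\<^sub>v w"
    \<comment> \<open>Solving the coarse equation \<open>Ac x = y\<close> brings the coarse residual into the shape to which
        the bounds for \<open>C\<close> apply.\<close>
    define x where "x = minv Ac *\<^sub>v y"
    define s where "s = qform (symmetrized_smoother A M) w"
    have Y: "transpose_mat P * (1\<^sub>m n - A * M) \<in> carrier_mat m n"
      using A M P by (simp add: minus_carrier_mat)
    have w: "w \<in> carrier_vec n" and y: "y \<in> carrier_vec m" and x: "x \<in> carrier_vec m"
      using A Y Ai v by (auto simp: w_def y_def x_def)
    have yx: "y = Ac *\<^sub>v x"
    proof -
      have "Ac *\<^sub>v (minv Ac *\<^sub>v y) = (Ac * minv Ac) *\<^sub>v y" using Ac Ai(1) y by simp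
      then show ?thesis using y by (simp add: x_def Ai(2))
    qed
    have "0 \<le> s" unfolding s_def w_def by (rule symmetrized_smoother_nonneg[OF A M norm v])
    have g: "qform (minv Ac) y = qform Ac x"
      using comm_scalar_prod[OF x y] by (simp add: qform_def x_def[symmetric] yx[symmetric])
    have C': "lo * qform Ac x \<le> qform C y" "qform C y \<le> hi * qform Ac x"
      using C(3) Ac x qform_correction[OF Ac(1) symAc C(1) x] by (auto simp: energy_bounds_def yx)
    have form: "qform (A * (cycle_op A M P D * A)) v = s + qform D y"
      if "D \<in> carrier_mat m m" "symmetric_mat D" for D
      using qform_correction[OF A(1) symA cyc[OF that] v] qform_cycle_op[OF A(1) symA M P that(1) w]
      by (simp add: s_def y_def w_def)
    have tg': "c * qform A v \<le> s + qform Ac x" "s + qform Ac x \<le> qform A v"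
      using tg A v form[OF Ai(1,4)] g by (auto simp: energy_bounds_def)
    have "lo * (c * qform A v) \<le> lo * (s + qform Ac x)" using tg'(1) lohi(1) by (rule mult_left_mono)
    moreover have "lo * s \<le> s" using \<open>0 \<le> s\<close> lohi(2) by (simp add: mult_left_le_one_le lohi(1))
    moreover have "s \<le> hi * s" using \<open>0 \<le> s\<close> lohi(3) mult_right_mono[of 1 hi s] by simp
    moreover have "hi * (s + qform Ac x) \<le> hi * qform A v" using tg'(2) lohi(3) by (intro mult_left_mono) auto
    ultimately show ?thesis using C' form[OF C(1,2)] by (simp add: distrib_left mult.assoc)
  qed
  then show ?thesis using A by (simp add: energy_bounds_def)
qed

lemma energy_bounds_identity:
  assumes "A \<in> carrier_mat n n" "spd A" "lo \<le> 1" "1 \<le> hi"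
  shows "energy_bounds A (1\<^sub>m n) lo hi"
  using assms spdD(3)[OF assms(2,1)] mult_right_mono[of lo 1] mult_right_mono[of 1 hi]
  by (fastforce simp: energy_bounds_def)

text \<open>
  The polynomially corrected solver \<open>C\<close> satisfies \<open>C A = q(B A)\<close> with \<open>q = 1 - p\<close>, so its bounds
  come from spectral mapping. It is symmetric since it is the congruence transform of the
  symmetric matrix \<open>A q(B A)\<close> by the inverse of \<open>A\<close>.
\<close>

lemma polynomial_correction:
  assumes A: "A \<in> carrier_mat n n" "spd A" and n: "0 < n"
    and B: "B \<in> carrier_mat n n" "symmetric_mat B" and b: "energy_bounds A (B * A) lo hi"
    and p: "\<And>x. lo \<le> x \<Longrightarrow> x \<le> hi \<Longrightarrow> c \<le> 1 - poly p x \<and> 1 - poly p x \<le> d"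
  defines "C \<equiv> (1\<^sub>m n - poly_mat p (B * A)) * minv A"
  shows "C \<in> carrier_mat n n" "symmetric_mat C" "energy_bounds A (C * A) c d"
proof -
  note symA = spdD(1)[OF A(2,1)] and Ai = minv_spd[OF A]
  have T: "B * A \<in> carrier_mat n n" "symmetric_mat (A * (B * A))"
    using A B symmetric_correction[OF A(1) symA B] by auto
  let ?q = "[:1:] + Polynomial.smult (-1) p"
  note P = poly_mat_carrier[OF T(1), of p] and Q = poly_mat_carrier[OF T(1), of ?q]
  have q: "poly_mat ?q (B * A) = 1\<^sub>m n - poly_mat p (B * A)"
    unfolding poly_mat_add[OF T(1)] poly_mat_smult[OF T(1)] poly_mat_const[OF T(1)]
    using P by (auto intro!: eq_matI)
  show C: "C \<in> carrier_mat n n" 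
    unfolding C_def by (intro mult_carrier_mat[of _ n n] minus_carrier_mat P Ai)
  have "C * A = poly_mat ?q (B * A)"
    unfolding C_def q[symmetric] using A Q Ai right_mult_one_mat[OF Q] by (simp add: assoc_mult_mat[of _ n n _ n _ n])
  then show "energy_bounds A (C * A) c d"
    using energy_bounds_poly_mat[OF A T n b, of c ?q d] p by simp
  have "minv A * (A * poly_mat ?q (B * A)) = (minv A * A) * poly_mat ?q (B * A)"
    by (rule assoc_mult_mat[OF Ai(1) A(1) Q, symmetric])
  then have "transpose_mat (minv A) * (A * poly_mat ?q (B * A)) * minv A = (minv A * A) * poly_mat ?q (B * A) * minv A"
    using Ai(4) by (simp only: symmetric_mat_def)
  also have "\<dots> = C" by (simp only: C_def q[symmetric] Ai(3) left_mult_one_mat[OF Q])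
  finally have "C = transpose_mat (minv A) * (A * poly_mat ?q (B * A)) * minv A" by simp
  then show "symmetric_mat C"
    using symmetric_mat_congruence[OF _ symmetric_poly_mat[OF A(1) symA T, of ?q] Ai(1)] A Q by simp
qed

section \<open>The AMLI induction for a general polynomial\<close>

text \<open>
  Only two features of \<open>p\<close> enter: on \<open>[\<mu>, L]\<close> the correction \<open>1 - p\<close> stays above \<open>\<mu> / (1 - \<delta>)\<close>, so that
  the two-grid loss \<open>1 - \<delta>\<close> leads back to \<open>\<mu>\<close>, and it stays below \<open>L\<close>. The exact solver on
  the coarsest level satisfies both sets of bounds because \<open>\<mu> \<le> 1 - \<delta> \<le> 1 \<le> L\<close>.
\<close>

theorem amli_condition_number:
  assumes setting: "amli_setting J n A P M" and tg: "two_grid_converges J A P M \<delta>"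
    and \<mu>: "0 < \<mu>" "\<mu> \<le> 1 - \<delta>" and L: "1 \<le> L"
    and p: "\<And>x. \<mu> \<le> x \<Longrightarrow> x \<le> L \<Longrightarrow> \<mu> \<le> (1 - \<delta>) * (1 - poly p x) \<and> 1 - poly p x \<le> L"
    and l: "l \<in> {1..J}"
  shows "cond_le (amli_B p J A P M l * A l) (L / \<mu>)"
proof -
  have \<delta>: "0 < 1 - \<delta>" using tg by (simp add: two_grid_converges_def)
  define m where "m = \<mu> / (1 - \<delta>)"
  have m: "0 \<le> m" "m \<le> 1" "m * (1 - \<delta>) = \<mu>" using \<mu> \<delta> by (auto simp: m_def)
  have pm: "m \<le> 1 - poly p x \<and> 1 - poly p x \<le> L" if "\<mu> \<le> x" "x \<le> L" for x
    using p[OF that] \<delta> by (simp add: m_def pos_divide_le_eq mult.commute)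
  have lev: "0 < n k" "A k \<in> carrier_mat (n k) (n k)" "spd (A k)" if "k \<in> {1..J}" for k
    using setting that by (auto simp: amli_setting_def)
  define good where "good B k lo \<longleftrightarrow> B \<in> carrier_mat (n k) (n k) \<and> symmetric_mat B
    \<and> energy_bounds (A k) (B * A k) lo L" for B k lo
  have good: "good (amli_B p J A P M k) k \<mu> \<and> good (amli_Bhat p J A P M k) k m"
    if "k \<le> J" "1 \<le> k" for k
    using that
  proof (induction k rule: inc_induct)
    case base
    then have J: "J \<in> {1..J}" by simp
    note Ai = minv_spd[OF lev(2,3)[OF J]]
    have "good (minv (A J)) J lo" if "lo \<le> 1" for lo
      using Ai energy_bounds_identity[OF lev(2,3)[OF J] that L] by (simp add: good_def)
    then show ?case using m \<mu> tg by (simp add: amli_B.simps amli_Bhat.simps two_grid_converges_def)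
  next
    case (step k)
    then have k: "k \<in> {1..J}" "Suc k \<in> {1..J}" "k \<in> {1..<J}" by auto
    note Ak = lev[OF k(1)] and Ac = lev[OF k(2)]
    have M: "M k \<in> carrier_mat (n k) (n k)" "invertible_mat (M k)"
      and norm: "energy_onorm (A k) (1\<^sub>m (n k) - M k * A k) \<le> 1"
      and P: "P k \<in> carrier_mat (n k) (n (Suc k))"
      using setting k(3) by (auto simp: amli_setting_def)
    note symA = spdD(1)[OF Ak(3,2)] and Ai = minv_spd[OF Ac(2,3)]
    define C where "C = amli_Bhat p J A P M (Suc k)"
    have C: "C \<in> carrier_mat (n (Suc k)) (n (Suc k))" "symmetric_mat C" "energy_bounds (A (Suc k)) (C * A (Suc k)) m L"
      using step.IH step.prems by (auto simp: good_def C_def)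
    define TG where "TG = cycle_op (A k) (M k) (P k) (minv (A (Suc k)))"
    have TG: "TG \<in> carrier_mat (n k) (n k)" "symmetric_mat TG"
      using cycle_op_symmetric[OF Ak(2) symA M P Ai(1,4)] by (simp_all add: TG_def)
    have "energy_bounds (A k) (TG * A k) (1 - \<delta>) 1"
    proof (rule energy_bounds_of_spectrum[OF Ak(2,3) _ symmetric_correction[OF Ak(2) symA TG] Ak(1)])
      show "TG * A k \<in> carrier_mat (n k) (n k)" using TG Ak by simp
      show "1 - \<delta> \<le> lambda_min (TG * A k)" "lambda_max (TG * A k) \<le> 1"
        using tg k(3) by (auto simp: two_grid_converges_def two_grid_op_def TG_def)
    qed
    note bounds = cycle_op_energy_bounds[OF Ak(2,3) M norm P Ac(2,3) C m(1,2) L this[unfolded TG_def]]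
    define B where "B = amli_B p J A P M k"
    have B_eq: "B = cycle_op (A k) (M k) (P k) C" using k(3) by (simp add: B_def C_def amli_B.simps[of p J A P M k])
    have B: "B \<in> carrier_mat (n k) (n k)" "symmetric_mat B" "energy_bounds (A k) (B * A k) \<mu> L"
      using cycle_op_symmetric[OF Ak(2) symA M P C(1,2)] bounds by (simp_all add: B_eq m(3))
    have "amli_Bhat p J A P M k = (1\<^sub>m (n k) - poly_mat p (B * A k)) * minv (A k)"
      using k(3) Ak(2) by (simp add: B_def amli_Bhat.simps[of p J A P M k])
    then show ?case
      using B polynomial_correction[OF Ak(2,3,1) B pm] by (simp add: good_def B_def[symmetric])
  qed
  define B where "B = amli_B p J A P M l"
  note Al = lev[OF l]
  have B: "B \<in> carrier_mat (n l) (n l)" "symmetric_mat B" "energy_bounds (A l) (B * A l) \<mu> L"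
    using good[of l] l by (auto simp: good_def B_def)
  have "B * A l \<in> carrier_mat (n l) (n l)" using B Al by simp
  then show ?thesis
    using cond_le_of_energy_bounds[OF Al(2,3) _ symmetric_correction[OF Al(2) spdD(1)[OF Al(3,2)] B(1,2)] Al(1) B(3) \<mu>(1)]
    by (simp add: B_def)
qed

section \<open>The momentum-accelerated cubic\<close>

text \<open>
  For positive \<open>a\<close> this is the smaller critical point of the cubic, its local minimum.
\<close>

definition ma3_xmin :: "real \<Rightarrow> real" where
  "ma3_xmin a = (2 * a + 7 - sqrt (4 * (1 - a)\<^sup>2 + 9)) / (12 * a)"

lemma poly_ma_poly3_expand:
  "poly (ma_poly3 a) x = 1 - (3 * a + 3) * x + (7 * a + 2 * a\<^sup>2) * x\<^sup>2 - 4 * a\<^sup>2 * x ^ 3"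
  by (simp add: poly_ma_poly3 power2_eq_square power3_eq_cube algebra_simps)

text \<open>
  At a critical point the difference has a double root; the remaining linear factor is fixed by
  the sum of the three roots, \<open>(2 a + 7) / (4 a)\<close>.
\<close>

lemma ma3_minus_min:
  assumes "a \<noteq> 0"
  shows "poly (ma_poly3 a) x - poly (ma_poly3 a) (ma3_xmin a)
    = 4 * a\<^sup>2 * (x - ma3_xmin a)\<^sup>2 * ((2 * a + 7) / (4 * a) - 2 * ma3_xmin a - x)"
proof -
  define s where "s = sqrt (4 * (1 - a)\<^sup>2 + 9)"
  define y where "y = ma3_xmin a"
  have s2: "s\<^sup>2 = 4 * (1 - a)\<^sup>2 + 9" by (simp add: s_def)
  have y: "12 * a * y = 2 * a + 7 - s" using assms by (simp add: y_def ma3_xmin_def s_def)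
  \<comment> \<open>Eliminating the square root yields that the derivative vanishes at \<open>y\<close>.\<close>
  then have "(2 * a + 7 - 12 * a * y)\<^sup>2 = 4 * (1 - a)\<^sup>2 + 9" using s2 by simp
  then have "12 * (12 * a\<^sup>2 * y\<^sup>2 - 2 * (7 * a + 2 * a\<^sup>2) * y + (3 * a + 3)) = 0"
    by (simp add: power2_eq_square algebra_simps)
  then have crit: "3 * a + 3 = 2 * (7 * a + 2 * a\<^sup>2) * y - 12 * a\<^sup>2 * y\<^sup>2" by simp
  have "4 * a\<^sup>2 * (x - y)\<^sup>2 * ((2 * a + 7) / (4 * a) - 2 * y - x)
      = (x - y)\<^sup>2 * ((7 * a + 2 * a\<^sup>2) - 8 * a\<^sup>2 * y - 4 * a\<^sup>2 * x)"
    using assms by (simp add: field_simps power2_eq_square)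
  also have "\<dots> = poly (ma_poly3 a) x - poly (ma_poly3 a) y"
    unfolding poly_ma_poly3_expand crit by (simp add: power2_eq_square power3_eq_cube algebra_simps)
  finally show ?thesis by (simp add: y_def)
qed

lemma ma3_minus_end:
  "poly (ma_poly3 a) x - poly (ma_poly3 a) 1
    = (1 - x) * (4 * a\<^sup>2 * x\<^sup>2 - (7 * a - 2 * a\<^sup>2) * x + (3 - 4 * a + 2 * a\<^sup>2))"
  unfolding poly_ma_poly3_expand by (simp add: power2_eq_square power3_eq_cube algebra_simps)

text \<open>
  The quadratic on the right decides both whether the third root in \<open>ma3_minus_min\<close> is at least \<open>1\<close>
  and whether the quadratic factor in \<open>ma3_minus_end\<close> has real roots.
\<close>

lemma threshold_iff:
  assumes "0 < a"
  shows "a < (9 + 2 * sqrt 22) / 14 \<longleftrightarrow> 28 * a\<^sup>2 - 36 * a - 1 < 0"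
proof -
  define r where "r = sqrt (22::real)"
  have r2: "r\<^sup>2 = 22" and r: "9 / 2 < r"
    unfolding r_def by (simp, rule real_less_rsqrt) (simp add: power2_eq_square)
  have "7 * (28 * a\<^sup>2 - 36 * a - 1) = (14 * a - 9 - 2 * r) * (14 * a - 9 + 2 * r)"
    using r2 by (simp add: power2_eq_square algebra_simps)
  moreover have "0 < 14 * a - 9 + 2 * r" using r assms by simp
  ultimately have "28 * a\<^sup>2 - 36 * a - 1 < 0 \<longleftrightarrow> 14 * a - 9 - 2 * r < 0"
    by (smt (verit) mult_less_0_iff)
  then show ?thesis unfolding r_def[symmetric] by (auto simp: less_divide_eq)
qed

text \<open>
  Below the threshold, the third root of the cubic minus its critical value is at least \<open>1\<close>, so that
  value bounds the cubic from below on \<open>[0, 1]\<close>, even for small \<open>a\<close>, when the critical point lies to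
  the right of \<open>1\<close>. Above the threshold, the cubic minus its value at \<open>1\<close> is \<open>1 - x\<close> times
  a quadratic with nonpositive discriminant.
\<close>

lemma ma3_ge_1_minus_L:
  assumes a: "0 < a" and x: "0 \<le> x" "x \<le> 1"
  shows "1 - ma3_L a \<le> poly (ma_poly3 a) x"
proof (cases "a < (9 + 2 * sqrt 22) / 14")
  case True
  define s where "s = sqrt (4 * (1 - a)\<^sup>2 + 9)"
  have s2: "s\<^sup>2 = 4 * (1 - a)\<^sup>2 + 9" and s0: "0 \<le> s" by (simp_all add: s_def)
  have "(10 * a - 7)\<^sup>2 \<le> (2 * s)\<^sup>2"
    using True threshold_iff[OF a] s2 by (simp add: power2_eq_square algebra_simps)
  then have "10 * a - 7 \<le> 2 * s" by (rule power2_le_imp_le) (use s0 in simp)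
  moreover have "12 * (a * ma3_xmin a) = 2 * a + 7 - s" using a by (simp add: ma3_xmin_def s_def)
  moreover have "4 * a * ((2 * a + 7) / (4 * a) - 2 * ma3_xmin a) = 2 * a + 7 - 8 * (a * ma3_xmin a)"
    using a by (simp add: right_diff_distrib)
  ultimately have "4 * a * 1 \<le> 4 * a * ((2 * a + 7) / (4 * a) - 2 * ma3_xmin a)" by linarith
  then have "1 \<le> (2 * a + 7) / (4 * a) - 2 * ma3_xmin a"
    using a by (subst (asm) mult_le_cancel_left_pos) simp_all
  then have "0 \<le> poly (ma_poly3 a) x - poly (ma_poly3 a) (ma3_xmin a)"
    unfolding ma3_minus_min[OF less_imp_neq[OF a, symmetric]] using x by simp
  then show ?thesis using True by (simp add: ma3_L_def ma3_xmin_def)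
next
  case False
  then have d: "0 \<le> 28 * a\<^sup>2 - 36 * a - 1" using threshold_iff[OF a] by simp
  have "16 * (4 * a\<^sup>2 * x\<^sup>2 - (7 * a - 2 * a\<^sup>2) * x + (3 - 4 * a + 2 * a\<^sup>2))
      = (8 * a * x - (7 - 2 * a))\<^sup>2 + (28 * a\<^sup>2 - 36 * a - 1)"
    by (simp add: power2_eq_square algebra_simps)
  also have "0 \<le> \<dots>" by (intro add_nonneg_nonneg zero_le_power2 d)
  finally have "0 \<le> 4 * a\<^sup>2 * x\<^sup>2 - (7 * a - 2 * a\<^sup>2) * x + (3 - 4 * a + 2 * a\<^sup>2)"
    by (simp only: zero_le_mult_iff) simp
  then have "0 \<le> poly (ma_poly3 a) x - poly (ma_poly3 a) 1"
    unfolding ma3_minus_end using x by simp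
  moreover have "poly (ma_poly3 a) 1 = - 2 * (a - 1)\<^sup>2"
    by (simp add: poly_ma_poly3 power2_eq_square algebra_simps)
  ultimately show ?thesis using False by (simp add: ma3_L_def)
qed

lemma ma3_L_ge_1:
  assumes a: "0 < a"
  shows "1 \<le> ma3_L a"
proof -
  have "1 - ma3_L a \<le> poly (ma_poly3 a) 1" using ma3_ge_1_minus_L[OF a] by simp
  also have "\<dots> = - 2 * (a - 1)\<^sup>2" by (simp add: poly_ma_poly3 power2_eq_square algebra_simps)
  also have "\<dots> \<le> 0" by simp
  finally show ?thesis by simp
qed

lemma poly_ma3_scaled: "poly (ma3_scaled a) x = poly (ma_poly3 a) (x / ma3_L a)"
  by (simp add: ma3_scaled_def poly_pcompose)

lemma antimono_plateau_le:
  fixes f :: "real \<Rightarrow> real"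
  assumes "antimono_on {0<..\<nu>} f" "\<forall>x \<in> {\<nu>..1}. f x \<le> f \<nu>" "0 < t" "t \<le> \<nu>" "t \<le> x" "x \<le> 1"
  shows "f x \<le> f t"
proof (cases "x \<le> \<nu>")
  case True
  then show ?thesis using assms by (auto intro: monotone_onD)
next
  case False
  then have "f x \<le> f \<nu>" using assms by simp
  also have "f \<nu> \<le> f t" using assms by (auto intro: monotone_onD)
  finally show ?thesis .
qed

text \<open>
  With \<open>\<mu> = L t\<close> and \<open>t > 0\<close>, dropping the cubic term of \<open>1 - p\<close> leaves the sufficient condition
  \<open>L \<le> c ((3 a + 3) - d t)\<close>, where \<open>d\<close> is the quadratic coefficient. By hypothesis it holds strictly
  at \<open>t = 0\<close>, so it holds for \<open>t \<le> g / (c d)\<close>, where \<open>g = c (3 a + 3) - L\<close> is the slack.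
\<close>

lemma ma3_fixed_point_exists:
  assumes a: "0 < a" and L: "1 \<le> ma3_L a" and c: "ma3_L a / (3 * a + 3) < c" and b: "0 < b"
  shows "\<exists>\<mu>. 0 < \<mu> \<and> \<mu> \<le> b \<and> \<mu> \<le> c * (1 - poly (ma3_scaled a) \<mu>)"
proof -
  define L where "L = ma3_L a"
  have L0: "0 < L" using L by (simp add: L_def)
  have c0: "0 < c" using c L a by (smt (verit) divide_nonneg_pos)
  define g where "g = c * (3 * a + 3) - L"
  have g: "0 < g" using c a by (simp add: g_def L_def pos_divide_less_eq)
  define d where "d = 7 * a + 2 * a\<^sup>2"
  have d: "0 < d" using a by (simp add: d_def add_pos_nonneg)
  define t where "t = min (b / L) (g / (c * d))"
  have t: "0 < t" using b L0 g c0 d by (simp add: t_def)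
  have "t * (c * d) \<le> g" using c0 d by (simp add: t_def pos_le_divide_eq[symmetric])
  then have "t * (c * d * t) \<le> t * g" using t by (simp add: mult.commute mult.left_commute)
  then have "L * t \<le> c * ((3 * a + 3) * t - d * t\<^sup>2)"
    by (simp add: g_def power2_eq_square algebra_simps)
  also have "\<dots> \<le> c * (1 - poly (ma_poly3 a) t)"
    using c0 t by (intro mult_left_mono) (auto simp: poly_ma_poly3_expand d_def)
  finally have "L * t \<le> c * (1 - poly (ma3_scaled a) (L * t))"
    using L0 by (simp add: poly_ma3_scaled L_def)
  moreover have "t \<le> b / L" by (simp add: t_def)
  then have "L * t \<le> b" using L0 by (simp add: pos_le_divide_eq mult.commute)
  ultimately show ?thesis using L0 t by (intro exI[of _ "L * t"]) simp
qed

section \<open>Condition number of the momentum-accelerated AMLI-cycle\<close>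

theorem corollary3:
  fixes J :: nat and n :: "nat \<Rightarrow> nat"
    and A P M :: "nat \<Rightarrow> real mat"
    and \<delta> a \<nu> :: real
  assumes "amli_setting J n A P M"
    and "two_grid_converges J A P M \<delta>"
    and "0 < a" and "a < 2"
    and "0 < \<nu>" and "\<nu> < 1"
    and "0 \<le> poly (ma_poly3 a) \<nu>"
    and "antimono_on {0<..\<nu>} (poly (ma_poly3 a))"
    and "\<forall>x \<in> {\<nu>..1}. poly (ma_poly3 a) x \<le> poly (ma_poly3 a) \<nu>"
  shows "(\<forall>\<mu>. 0 < \<mu> \<and> \<mu> \<le> min (ma3_L a * \<nu>) (1 - \<delta>) \<and>
              \<mu> \<le> (1 - \<delta>) * (1 - poly (ma3_scaled a) \<mu>) \<longrightarrow>
            (\<forall>l \<in> {1..J}. cond_le (amli_B (ma3_scaled a) J A P M l * A l) (ma3_L a / \<mu>)))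
       \<and> (\<delta> < (if a < (9 + 2 * sqrt 22) / 14
               then 1 - (1 - poly (ma_poly3 a) ((2 * a + 7 - sqrt (4 * (1 - a)^2 + 9)) / (12 * a)))
                        / (3 * a + 3)
               else 1 - (1 + 2 * (a - 1)^2) / (3 * a + 3)) \<longrightarrow>
          (\<exists>\<mu>. 0 < \<mu> \<and> \<mu> \<le> min (ma3_L a * \<nu>) (1 - \<delta>) \<and>
              \<mu> \<le> (1 - \<delta>) * (1 - poly (ma3_scaled a) \<mu>)))"
proof (intro conjI allI impI ballI)
  define L where "L = ma3_L a"
  have L: "1 \<le> L" using ma3_L_ge_1[OF assms(3)] by (simp add: L_def)
  have \<delta>: "0 < 1 - \<delta>" using assms(2) by (simp add: two_grid_converges_def)
  {
    fix \<mu> l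
    assume *: "0 < \<mu> \<and> \<mu> \<le> min (ma3_L a * \<nu>) (1 - \<delta>) \<and> \<mu> \<le> (1 - \<delta>) * (1 - poly (ma3_scaled a) \<mu>)"
      and l: "l \<in> {1..J}"
    have "cond_le (amli_B (ma3_scaled a) J A P M l * A l) (L / \<mu>)"
    proof (rule amli_condition_number[OF assms(1,2) _ _ L _ l])
      show "0 < \<mu>" "\<mu> \<le> 1 - \<delta>" using * by auto
      fix x assume x: "\<mu> \<le> x" "x \<le> L"
      have "poly (ma_poly3 a) (x / L) \<le> poly (ma_poly3 a) (\<mu> / L)"
        using * x L by (intro antimono_plateau_le[OF assms(8,9)])
          (auto simp: L_def pos_divide_le_eq divide_right_mono mult.commute)
      then have "(1 - \<delta>) * (1 - poly (ma3_scaled a) \<mu>) \<le> (1 - \<delta>) * (1 - poly (ma3_scaled a) x)"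
        using \<delta> by (simp add: poly_ma3_scaled L_def)
      moreover have "1 - L \<le> poly (ma3_scaled a) x"
        using ma3_ge_1_minus_L[OF assms(3), of "x / L"] * x L by (simp add: poly_ma3_scaled L_def)
      ultimately show "\<mu> \<le> (1 - \<delta>) * (1 - poly (ma3_scaled a) x) \<and> 1 - poly (ma3_scaled a) x \<le> L"
        using * by linarith
    qed
    then show "cond_le (amli_B (ma3_scaled a) J A P M l * A l) (ma3_L a / \<mu>)" by (simp add: L_def)
  next
    assume "\<delta> < (if a < (9 + 2 * sqrt 22) / 14
               then 1 - (1 - poly (ma_poly3 a) ((2 * a + 7 - sqrt (4 * (1 - a)^2 + 9)) / (12 * a)))
                        / (3 * a + 3)
               else 1 - (1 + 2 * (a - 1)^2) / (3 * a + 3))"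
    then have "ma3_L a / (3 * a + 3) < 1 - \<delta>" by (simp add: ma3_L_def split: if_splits)
    then show "\<exists>\<mu>. 0 < \<mu> \<and> \<mu> \<le> min (ma3_L a * \<nu>) (1 - \<delta>) \<and>
        \<mu> \<le> (1 - \<delta>) * (1 - poly (ma3_scaled a) \<mu>)"
      using \<delta> L assms(3,5) by (intro ma3_fixed_point_exists) (auto simp: L_def)
  }
qed

end
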